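(* Let $\hat\pi^\bullet=\{\hat\pi^u:u\in\mathbb Z^2\}\in\hat{\mathcal G}$ be a shift-covariant coalescing system of random geodesics on $(\hat\Omega,\hat{\mathfrak S},\hat{\mathbb P},\hat T)$ and let $\hat B=B_{\hat\pi^0}$ be the Busemann function generated by $\hat\pi^0$. Then $$\hat{\mathbb P}\{\forall u\in\mathbb Z^2:\ x^{\hat B,u}=\hat\pi^u\}=1.$$ Moreover, if $(\hat\Omega,\hat{\mathfrak S},\hat{\mathbb P},\hat T)$ is ergodic, then $\hat\pi^\bullet\in\hat{\mathcal G}$ implies $B_{\hat\pi^0}\in\hat{\mathcal K}_c$.
   Context: Extended space. $(\hat\Omega,\hat{\mathfrak S},\hat{\mathbb P})$ is a Polish probability space with a group of continuous bijections $\hat T=\{\hat T_x:x\in\mathbb Z^2\}$ of $\hat\Omega$ onto itself ($\hat T_0$ is the identity, $\hat T_x\hat T_y=\hat T_{x+y}$); $\hat{\mathbb P}$ is invariant under every $\hat T_x$. There are given random variables $\omega_x:\hat\Omega\to\mathbb R$, $x\in\mathbb Z^2$, with $\omega_x(\hat T_z\hat\omega)=\omega_{x+z}(\hat\omega)$ almost surely, i.i.d. under $\hat{\mathbb P}$ with $\hat{\mathbb E}[|\omega_0|^{2+\epsilon}]<\infty$ for some $\epsilon>0$ and $\hat{\mathbb E}[\omega_0^2]>\hat{\mathbb E}[\omega_0]^2$. Write $\omega(\hat\omega)=(\omega_x(\hat\omega))_{x\in\mathbb Z^2}$. The system $(\hat\Omega,\hat{\mathfrak S},\hat{\mathbb P},\hat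 T)$ is ergodic if $\hat{\mathbb P}(H)\in\{0,1\}$ for every $H\in\hat{\mathfrak S}$ with $\hat T_xH=H$ for all $x\in\mathbb Z^2$. Last-passage percolation. $e_1=(1,0)$, $e_2=(0,1)$, $\mathbb Z_+=\{0,1,\dots\}$. Up-right paths take steps in $\{e_1,e_2\}$ and are indexed by level: $\pi_i\cdot(e_1+e_2)=i$. For weights $\omega\in\mathbb R^{\mathbb Z^2}$ and $u\le v$ (coordinatewise), $u\neq v$, $L_{u,v}(\omega)=\max\sum_{x\in\pi\setminus\{v\}}\omega_x$ over up-right paths $\pi$ from $u$ to $v$ (and $L_{u,u}=0$); maximizers are geodesics. The rightmost geodesic from $u$ to $v$ is the one lying weakly to the right (southeast) of all others. A semi-infinite geodesic is a semi-infinite up-right path all of whose finite segments are geodesics between their endpoints; it is locally rightmost if all of these segments are rightmost geodesics. $\mathrm{Geo}_u^\omega$ is the set of locally rightmost semi-infinite geodesics started at $u$. A semi-infinite geodesic is trivial if it is $u+\mathbb Z_+e_1$ or $u+\mathbb Z_+e_2$. Two semi-infinite paths coalesce if they agree at all sufficiently large levels. $\mathbb X_u$ is the space of semi-infinite up-right paths from $u$, with the product-discrete topology. Busemann functions of geodesics. Almost surely, for every nontrivial semi-infinite geodesic $\pi$ in $\omega$, the finite limits $B_\pi(\omega,x,y)=\lim_{n\to\infty}(L_{x,\pi_n}(\omega)-L_{y,\pi_n}(\omega))$ exist for all $x,y\in\mathbb Z^2$. For a random geodesic $\hat\pi^u$, set $B_{\hat\pi^u}(\hat\omega,x,y)=B_{\hat\pi^u(\hat\omega)}(\omega(\hat\omega),x,y)$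 (members of a coalescing system are nontrivial). Systems of geodesics. A random geodesic out of $u$ is a measurable map $\hat\pi:\hat\Omega\to\mathbb X_u$ with $\hat\pi(\hat\omega)\in\mathrm{Geo}_u^{\omega(\hat\omega)}$ a.s. A system of random geodesics is a family $\{\hat\pi^u:u\in\mathbb Z^2\}$ with $\hat\pi^u$ a random geodesic out of $u$. It is coalescing if a.s. $\hat\pi^u$ and $\hat\pi^v$ coalesce for all $u,v$, and shift-covariant if a.s. $\hat\pi^u(\hat\omega)=u+\hat\pi^0(\hat T_u\hat\omega)$ for all $u$. $\hat{\mathcal G}$ is the set of shift-covariant coalescing systems of random geodesics. Cocycles. $b:\mathbb Z^2\times\mathbb Z^2\to\mathbb R$ is a cocycle if $b(x,y)+b(y,z)=b(x,z)$ for all $x,y,z$; it recovers $\omega$ if $\min\{b(x,x+e_1),b(x,x+e_2)\}=\omega_x$ for all $x$. $\hat{\mathcal K}$ is the set of measurable $\hat B:\hat\Omega\times\mathbb Z^2\times\mathbb Z^2\to\mathbb R$ such that a.s. $\hat B(\hat\omega,\cdot,\cdot)$ is a cocycle recovering $\omega(\hat\omega)$, a.s. $\hat B(\hat\omega,x+z,y+z)=\hat B(\hat T_z\hat\omega,x,y)$ for all $x,y,z$, and $\hat{\mathbb E}|\hat B(x,y)|<\infty$ for all $x,y$. For a measurable random recovering cocycle $\hat B$, $x^{\hat B,u}(\hat\omega)$ is the semi-infinite path started at $u$ which from each visited site $x$ steps to $x+e_1$ if $\hat B(\hat\omega,x,x+e_1)\le\hat B(\hat\omega,x,x+e_2)$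 and to $x+e_2$ otherwise. $\hat{\mathcal K}_c$ is the set of $\hat B\in\hat{\mathcal K}$ such that a.s. $x^{\hat B,u}$ and $x^{\hat B,v}$ coalesce for all $u,v$. *)

theory Defs
  imports "HOL-Probability.Probability"
begin

section \<open>Last-passage percolation on the planar lattice\<close>

type_synonym site = "int \<times> int"

definition e1 :: site where "e1 = (1, 0)"
definition e2 :: site where "e2 = (0, 1)"

definition level :: "site \<Rightarrow> int" where
  "level x = fst x + snd x"

definition up_right_step :: "site \<Rightarrow> site \<Rightarrow> bool" where
  "up_right_step x y \<longleftrightarrow> y = x + e1 \<or> y = x + e2"

definition finite_paths :: "site \<Rightarrow> site \<Rightarrow> site list set" where
  "finite_paths u v =
     {p. p \<noteq> [] \<and> hd p = u \<and> last p = v \<and> successively up_right_step p}"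

text \<open>The weight of the endpoint is left out.\<close>

definition passage_time :: "(site \<Rightarrow> real) \<Rightarrow> site list \<Rightarrow> real" where
  "passage_time \<omega> p = (\<Sum>x\<leftarrow>butlast p. \<omega> x)"

text \<open>The only path from \<open>u\<close> to \<open>u\<close> is \<open>[u]\<close>, so that \<open>last_passage \<omega> u u = 0\<close>.
  The value is meaningful only when \<open>u \<le> v\<close> coordinatewise; otherwise there is no path from
  \<open>u\<close> to \<open>v\<close>, and the value is the unspecified constant \<open>Max {}\<close>.\<close>

definition last_passage :: "(site \<Rightarrow> real) \<Rightarrow> site \<Rightarrow> site \<Rightarrow> real" where
  "last_passage \<omega> u v = Max (passage_time \<omega> ` finite_paths u v)"

definition geodesics :: "(site \<Rightarrow> real) \<Rightarrow> site \<Rightarrow> site \<Rightarrow> site list set" where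
  "geodesics \<omega> u v = {p \<in> finite_paths u v. passage_time \<omega> p = last_passage \<omega> u v}"

text \<open>All paths from \<open>u\<close> to \<open>v\<close> have the same length, and their entries with the same
  position are at the same level.\<close>

definition weakly_right :: "site list \<Rightarrow> site list \<Rightarrow> bool" where
  "weakly_right p q \<longleftrightarrow>
     (\<forall>i<length p. fst (q ! i) \<le> fst (p ! i) \<and> snd (p ! i) \<le> snd (q ! i))"

definition rightmost_geodesic :: "(site \<Rightarrow> real) \<Rightarrow> site \<Rightarrow> site \<Rightarrow> site list \<Rightarrow> bool" where
  "rightmost_geodesic \<omega> u v p \<longleftrightarrow>
     p \<in> geodesics \<omega> u v \<and> (\<forall>q\<in>geodesics \<omega> u v. weakly_right p q)"

text \<open>A semi-infinite path from \<open>u\<close> is indexed by the number of steps taken: \<open>\<pi> n\<close> is its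
  point at level \<open>level u + n\<close>.\<close>

definition paths_from :: "site \<Rightarrow> (nat \<Rightarrow> site) set" where
  "paths_from u = {\<pi>. \<pi> 0 = u \<and> (\<forall>n. up_right_step (\<pi> n) (\<pi> (Suc n)))}"

definition segment :: "(nat \<Rightarrow> site) \<Rightarrow> nat \<Rightarrow> nat \<Rightarrow> site list" where
  "segment \<pi> m n = map \<pi> [m..<Suc n]"

definition Geo :: "(site \<Rightarrow> real) \<Rightarrow> site \<Rightarrow> (nat \<Rightarrow> site) set" where
  "Geo \<omega> u = {\<pi> \<in> paths_from u.
     \<forall>m n. m \<le> n \<longrightarrow> rightmost_geodesic \<omega> (\<pi> m) (\<pi> n) (segment \<pi> m n)}"

text \<open>Agreement at all sufficiently large levels; the paths may start at different levels.\<close>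

definition coalesce :: "(nat \<Rightarrow> site) \<Rightarrow> (nat \<Rightarrow> site) \<Rightarrow> bool" where
  "coalesce \<pi> \<rho> \<longleftrightarrow>
     (\<exists>N. \<forall>m n. level (\<pi> m) \<ge> N \<and> level (\<pi> m) = level (\<rho> n) \<longrightarrow> \<pi> m = \<rho> n)"

text \<open>For a member of a coalescing system of geodesics, \<open>\<pi> n\<close> eventually lies on the geodesics of
  the system from \<open>x\<close> and \<open>y\<close>, hence \<open>x, y \<le> \<pi> n\<close> for large \<open>n\<close> and the limit exists.\<close>

definition busemann :: "(site \<Rightarrow> real) \<Rightarrow> (nat \<Rightarrow> site) \<Rightarrow> site \<Rightarrow> site \<Rightarrow> real" where
  "busemann \<omega> \<pi> x y = lim (\<lambda>n. last_passage \<omega> x (\<pi> n) - last_passage \<omega> y (\<pi> n))"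

definition cocycle :: "(site \<Rightarrow> site \<Rightarrow> real) \<Rightarrow> bool" where
  "cocycle b \<longleftrightarrow> (\<forall>x y z. b x y + b y z = b x z)"

definition recovers :: "(site \<Rightarrow> site \<Rightarrow> real) \<Rightarrow> (site \<Rightarrow> real) \<Rightarrow> bool" where
  "recovers b \<omega> \<longleftrightarrow> (\<forall>x. min (b x (x + e1)) (b x (x + e2)) = \<omega> x)"

primrec cocycle_path :: "(site \<Rightarrow> site \<Rightarrow> real) \<Rightarrow> site \<Rightarrow> nat \<Rightarrow> site" where
  "cocycle_path b u 0 = u"
| "cocycle_path b u (Suc n) =
     (let x = cocycle_path b u n in if b x (x + e1) \<le> b x (x + e2) then x + e1 else x + e2)"


section \<open>The extended probability space\<close>

locale extended_space = prob_space M
  for M :: "'a::polish_space measure" +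
  fixes T :: "site \<Rightarrow> 'a \<Rightarrow> 'a"
    and w :: "site \<Rightarrow> 'a \<Rightarrow> real"
  assumes sets_M: "sets M = sets borel"
    and T_zero: "T 0 = id"
    and T_add: "T x \<circ> T y = T (x + y)"
    and T_bij: "bij (T x)"
    and T_continuous: "continuous_on UNIV (T x)"
    and T_invariant: "distr M M (T x) = M"
    and w_measurable: "w x \<in> borel_measurable M"
    and w_shift: "AE \<xi> in M. w x (T z \<xi>) = w (x + z) \<xi>"
    and w_indep: "indep_vars (\<lambda>_. borel) w UNIV"
    and w_identical: "distr M borel (w x) = distr M borel (w 0)"
    and w_moment: "\<exists>\<epsilon>>0. integrable M (\<lambda>\<xi>. \<bar>w 0 \<xi>\<bar> powr (2 + \<epsilon>))"
    and w_variance: "expectation (\<lambda>\<xi>. (w 0 \<xi>)\<^sup>2) > (expectation (w 0))\<^sup>2"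

definition ergodic :: "'a measure \<Rightarrow> (site \<Rightarrow> 'a \<Rightarrow> 'a) \<Rightarrow> bool" where
  "ergodic M T \<longleftrightarrow>
     (\<forall>H\<in>sets M. (\<forall>x. T x ` H = H) \<longrightarrow> measure M H \<in> {0, 1})"

definition weights :: "(site \<Rightarrow> 'a \<Rightarrow> real) \<Rightarrow> 'a \<Rightarrow> site \<Rightarrow> real" where
  "weights w \<xi> = (\<lambda>x. w x \<xi>)"

text \<open>Here \<open>borel\<close> on \<open>nat \<Rightarrow> site\<close> is generated by the product of the discrete topologies.\<close>

definition random_geodesic ::
  "'a measure \<Rightarrow> (site \<Rightarrow> 'a \<Rightarrow> real) \<Rightarrow> site \<Rightarrow> ('a \<Rightarrow> nat \<Rightarrow> site) \<Rightarrow> bool" where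
  "random_geodesic M w u \<pi> \<longleftrightarrow>
     \<pi> \<in> M \<rightarrow>\<^sub>M restrict_space borel (paths_from u) \<and>
     (AE \<xi> in M. \<pi> \<xi> \<in> Geo (weights w \<xi>) u)"

definition geodesic_system ::
  "'a measure \<Rightarrow> (site \<Rightarrow> 'a \<Rightarrow> real) \<Rightarrow> (site \<Rightarrow> 'a \<Rightarrow> nat \<Rightarrow> site) \<Rightarrow> bool" where
  "geodesic_system M w \<pi> \<longleftrightarrow> (\<forall>u. random_geodesic M w u (\<pi> u))"

definition coalescing_system :: "'a measure \<Rightarrow> (site \<Rightarrow> 'a \<Rightarrow> nat \<Rightarrow> site) \<Rightarrow> bool" where
  "coalescing_system M \<pi> \<longleftrightarrow> (AE \<xi> in M. \<forall>u v. coalesce (\<pi> u \<xi>) (\<pi> v \<xi>))"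

definition shift_covariant ::
  "'a measure \<Rightarrow> (site \<Rightarrow> 'a \<Rightarrow> 'a) \<Rightarrow> (site \<Rightarrow> 'a \<Rightarrow> nat \<Rightarrow> site) \<Rightarrow> bool" where
  "shift_covariant M T \<pi> \<longleftrightarrow> (AE \<xi> in M. \<forall>u. \<pi> u \<xi> = (\<lambda>n. u + \<pi> 0 (T u \<xi>) n))"

definition G_hat ::
  "'a measure \<Rightarrow> (site \<Rightarrow> 'a \<Rightarrow> 'a) \<Rightarrow> (site \<Rightarrow> 'a \<Rightarrow> real) \<Rightarrow> (site \<Rightarrow> 'a \<Rightarrow> nat \<Rightarrow> site) set" where
  "G_hat M T w =
     {\<pi>. geodesic_system M w \<pi> \<and> coalescing_system M \<pi> \<and> shift_covariant M T \<pi>}"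

definition geodesic_busemann ::
  "(site \<Rightarrow> 'a \<Rightarrow> real) \<Rightarrow> ('a \<Rightarrow> nat \<Rightarrow> site) \<Rightarrow> 'a \<Rightarrow> site \<Rightarrow> site \<Rightarrow> real" where
  "geodesic_busemann w \<pi> \<xi> = busemann (weights w \<xi>) (\<pi> \<xi>)"

definition K_hat ::
  "'a measure \<Rightarrow> (site \<Rightarrow> 'a \<Rightarrow> 'a) \<Rightarrow> (site \<Rightarrow> 'a \<Rightarrow> real) \<Rightarrow> ('a \<Rightarrow> site \<Rightarrow> site \<Rightarrow> real) set" where
  "K_hat M T w =
     {B. (\<lambda>(\<xi>, x, y). B \<xi> x y)
            \<in> borel_measurable (M \<Otimes>\<^sub>M count_space UNIV \<Otimes>\<^sub>M count_space UNIV) \<and>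
         (AE \<xi> in M. cocycle (B \<xi>) \<and> recovers (B \<xi>) (weights w \<xi>)) \<and>
         (AE \<xi> in M. \<forall>x y z. B \<xi> (x + z) (y + z) = B (T z \<xi>) x y) \<and>
         (\<forall>x y. integrable M (\<lambda>\<xi>. B \<xi> x y))}"

definition K_hat_c ::
  "'a measure \<Rightarrow> (site \<Rightarrow> 'a \<Rightarrow> 'a) \<Rightarrow> (site \<Rightarrow> 'a \<Rightarrow> real) \<Rightarrow> ('a \<Rightarrow> site \<Rightarrow> site \<Rightarrow> real) set" where
  "K_hat_c M T w =
     {B \<in> K_hat M T w.
        AE \<xi> in M. \<forall>u v. coalesce (cocycle_path (B \<xi>) u) (cocycle_path (B \<xi>) v)}"

end

theory Submission
  imports Defs
begin

text \<open>
  Fix a realisation of the weights and of the geodesics. Since the geodesic from \<open>x\<close> merges into the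
  geodesic \<open>\<gamma>\<close> from \<open>0\<close>, the passage time from \<open>x\<close> to a far point of \<open>\<gamma>\<close> is the weight of a path of
  the system, and differences of passage times to that point do not change any more as it moves
  out along \<open>\<gamma>\<close>. The Busemann function \<open>B\<close> is this eventual value. It inherits the cocycle property,
  and the dynamic programming equation shows that it recovers the weights. A rightmost geodesic at
  \<open>x\<close> heading for a far point \<open>v\<close> steps to \<open>x + e1\<close> exactly if the passage time from \<open>x + e1\<close> to \<open>v\<close> is
  at least that from \<open>x + e2\<close>, that is, if \<open>B x (x + e1) \<le> B x (x + e2)\<close>; so the paths of \<open>B\<close> are
  the given geodesics (\<open>cocycle_path_busemann\<close>). All geodesics of the system generate the same
  Busemann function, which makes \<open>B\<close> shift-covariant.

  What remains is integrability in the ergodic case. It holds for every measurable covariant cocycle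
  that recovers the weights (\<open>cocycle_integrable\<close>). Put \<open>f = B 0 e1\<close> and \<open>g = B 0 e2\<close>; both are at
  least \<open>w 0\<close>, so only upper bounds are needed. Let \<open>\<gamma>\<close> be the path of \<open>B\<close> from \<open>0\<close>, along which
  \<open>B\<close> is the accumulated weight.

  If with probability bounded away from zero, for infinitely many \<open>k\<close>, a positive proportion of the
  first \<open>k\<close> steps of \<open>\<gamma>\<close> is in direction \<open>e1\<close>, then \<open>B 0 (n, 0)\<close> is at most a constant times \<open>n\<close> for
  infinitely many \<open>n\<close>, because the weights collected by any path of length \<open>k\<close> are of order
  \<open>k\<close> (\<open>tail_on_paths\<close>). This linear bound is an invariant event, hence almost sure, and the maximal
  ergodic lemma applied to truncations of \<open>f\<close> bounds the mean of \<open>f\<close>.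

  Otherwise the proportion of steps in direction \<open>e1\<close> tends to zero in probability. Paths in a
  narrow strip collect little more than the mean weight per step (\<open>narrow_paths\<close>), so that
  \<open>B 0 (0, n)\<close> is at most slightly more than \<open>n\<close> times the mean weight for some \<open>n\<close>. The maximal
  ergodic lemma now shows that the mean of \<open>g\<close> is at most that of \<open>w 0\<close>, whence \<open>g = w 0\<close> almost
  surely. By the cocycle property, \<open>f - f \<circ> T (0, n)\<close> is then a sum of \<open>n\<close> independent differences of
  two weights. The left side is tight in \<open>n\<close> and the right side is not, since the weights are not
  constant (\<open>differences_not_coboundary\<close>). So this case does not occur, and \<open>f\<close> is integrable. The
  reflection of the lattice gives integrability of \<open>g\<close>.

  The bound for arbitrary paths rests on counting chains. If sites are marked independently with
  probability \<open>p\<close> and a path of \<open>k\<close> sites contains \<open>N\<close> marked ones, then the box of side \<open>k\<close> contains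
  at least \<open>2 ^ N\<close> chains of marked sites. The expected number of such chains is at most
  \<open>(1 - sqrt p) powr (- 2 * k)\<close>, so the expected maximum of \<open>N\<close> is of order \<open>k * sqrt p\<close>. With
  more than two moments, this is summable over the levels of the weights.
\<close>

section \<open>Finite up-right paths and last-passage times\<close>

lemma level_add [simp]: "level (x + y) = level x + level y"
  by (simp add: level_def)

lemma level_unit [simp]: "level e1 = 1" "level e2 = 1"
  by (simp_all add: level_def e1_def e2_def)

lemma level_step: "up_right_step x y \<Longrightarrow> level y = level x + 1"
  by (auto simp: up_right_step_def)

lemma finite_paths_length:
  assumes "p \<in> finite_paths u v"
  shows "level v = level u + int (length p) - 1"
proof -
  have "p \<noteq> [] \<Longrightarrow> successively up_right_step p \<Longrightarrow>
      level (last p) = level (hd p) + int (length p) - 1" for p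
    by (induction p rule: induct_list012) (auto dest!: level_step)
  then show ?thesis
    using assms by (auto simp: finite_paths_def)
qed

lemma finite_paths_step:
  assumes "up_right_step u z" "p \<in> finite_paths z v"
  shows "u # p \<in> finite_paths u v"
  using assms by (cases p) (auto simp: finite_paths_def)

lemma finite_paths_rec:
  assumes "u \<noteq> v"
  shows "finite_paths u v = (#) u ` (finite_paths (u + e1) v \<union> finite_paths (u + e2) v)"
    (is "_ = ?R")
proof
  show "finite_paths u v \<subseteq> ?R"
  proof
    fix p assume p: "p \<in> finite_paths u v"
    then obtain z q where "p = u # z # q"
      using assms by (cases p; cases "tl p") (auto simp: finite_paths_def)
    with p have "z # q \<in> finite_paths z v" and z: "z = u + e1 \<or> z = u + e2"
      by (auto simp: finite_paths_def up_right_step_def)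
    then have "z # q \<in> finite_paths (u + e1) v \<union> finite_paths (u + e2) v"
      by auto
    with \<open>p = u # z # q\<close> show "p \<in> ?R"
      by simp
  qed
  show "?R \<subseteq> finite_paths u v"
    by (fastforce intro: finite_paths_step simp: up_right_step_def)
qed

lemma finite_finite_paths [simp]: "finite (finite_paths u v)"
proof (induction "nat (level v - level u + 1)" arbitrary: u)
  case 0
  have "finite_paths u v = {}"
  proof (rule ccontr)
    assume "finite_paths u v \<noteq> {}"
    then obtain p where p: "p \<in> finite_paths u v"
      by auto
    then have "length p \<ge> 1"
      by (cases p) (auto simp: finite_paths_def)
    with finite_paths_length[OF p] 0 show False
      by simp
  qed
  then show ?case
    by simp
next
  case (Suc n)
  show ?case
  proof (cases "u = v")
    case True
    have "finite_paths u u \<subseteq> {[u]}"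
    proof
      fix p assume p: "p \<in> finite_paths u u"
      with finite_paths_length[OF p] show "p \<in> {[u]}"
        by (cases p) (auto simp: finite_paths_def)
    qed
    then show ?thesis
      using True finite_subset by blast
  next
    case False
    have "n = nat (level v - level (u + e1) + 1)" "n = nat (level v - level (u + e2) + 1)"
      using Suc(2) by auto
    from Suc(1)[OF this(1)] Suc(1)[OF this(2)] show ?thesis
      by (subst finite_paths_rec[OF False]) auto
  qed
qed

lemma passage_time_Cons: "p \<noteq> [] \<Longrightarrow> passage_time \<omega> (x # p) = \<omega> x + passage_time \<omega> p"
  by (simp add: passage_time_def)

lemma passage_time_le_last_passage:
  "p \<in> finite_paths u v \<Longrightarrow> passage_time \<omega> p \<le> last_passage \<omega> u v"
  unfolding last_passage_def by (intro Max_ge) auto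

lemma geodesic_exists:
  assumes "finite_paths u v \<noteq> {}"
  obtains p where "p \<in> geodesics \<omega> u v"
proof -
  have "last_passage \<omega> u v \<in> passage_time \<omega> ` finite_paths u v"
    unfolding last_passage_def using assms by (intro Max_in) auto
  then show ?thesis
    using that by (auto simp: geodesics_def)
qed

text \<open>The dynamic programming equation for last-passage times.\<close>

lemma last_passage_rec:
  assumes ne: "finite_paths (u + e1) v \<noteq> {}" "finite_paths (u + e2) v \<noteq> {}"
  shows "last_passage \<omega> u v = \<omega> u + max (last_passage \<omega> (u + e1) v) (last_passage \<omega> (u + e2) v)"
proof -
  let ?S = "finite_paths (u + e1) v \<union> finite_paths (u + e2) v"
  obtain q where q: "q \<in> finite_paths (u + e1) v"
    using ne by auto
  have "u \<noteq> v"
    using finite_paths_length[OF q] q by (cases q) (auto simp: finite_paths_def)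
  have ne_path: "p \<noteq> []" if "p \<in> ?S" for p
    using that by (auto simp: finite_paths_def)
  have "passage_time \<omega> ` finite_paths u v = (\<lambda>p. \<omega> u + passage_time \<omega> p) ` ?S"
    unfolding finite_paths_rec[OF \<open>u \<noteq> v\<close>] image_image
    by (intro image_cong refl passage_time_Cons ne_path)
  then have "last_passage \<omega> u v = Max ((\<lambda>t. \<omega> u + t) ` passage_time \<omega> ` ?S)"
    by (simp add: last_passage_def image_image)
  also have "\<dots> = \<omega> u + Max (passage_time \<omega> ` ?S)"
    using ne by (subst mono_Max_commute[symmetric]) (auto simp: mono_def)
  also have "Max (passage_time \<omega> ` ?S) =
      max (last_passage \<omega> (u + e1) v) (last_passage \<omega> (u + e2) v)"
    using ne by (simp add: image_Un Max_Un last_passage_def)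
  finally show ?thesis .
qed

text \<open>The first step of a rightmost geodesic is \<open>e1\<close> exactly if starting in that direction
  costs nothing; ties are broken in favour of \<open>e1\<close>.\<close>

lemma rightmost_first_step:
  assumes p: "rightmost_geodesic \<omega> u v p" and step: "p = u # z # q"
    and ne: "finite_paths (u + e1) v \<noteq> {}" "finite_paths (u + e2) v \<noteq> {}"
  shows "z = (if last_passage \<omega> (u + e2) v \<le> last_passage \<omega> (u + e1) v then u + e1 else u + e2)"
proof -
  have geo: "p \<in> geodesics \<omega> u v" and right: "\<And>r. r \<in> geodesics \<omega> u v \<Longrightarrow> weakly_right p r"
    using p by (auto simp: rightmost_geodesic_def)
  from geo step have zq: "z # q \<in> finite_paths z v" and z: "z = u + e1 \<or> z = u + e2"
    by (auto simp: geodesics_def finite_paths_def up_right_step_def)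
  show ?thesis
  proof (cases "last_passage \<omega> (u + e2) v \<le> last_passage \<omega> (u + e1) v")
    case True
    obtain r where r: "r \<in> geodesics \<omega> (u + e1) v"
      using geodesic_exists[OF ne(1)] .
    then have r': "r \<in> finite_paths (u + e1) v" "r \<noteq> []" "hd r = u + e1"
      by (auto simp: geodesics_def finite_paths_def)
    have "u # r \<in> geodesics \<omega> u v"
      using r r' finite_paths_step[of u "u + e1" r v] last_passage_rec[OF ne, of \<omega>] True
      by (simp add: geodesics_def passage_time_Cons up_right_step_def max_def)
    from right[OF this] have "fst (hd r) \<le> fst z"
      using step r'(2) by (auto simp: weakly_right_def hd_conv_nth dest!: spec[of _ 1])
    then have "z = u + e1"
      using z r' by (auto simp: e1_def e2_def)
    then show ?thesis
      using True by simp
  next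
    case False
    have "z \<noteq> u + e1"
    proof
      assume "z = u + e1"
      have "last_passage \<omega> u v = \<omega> u + passage_time \<omega> (z # q)"
        using geo step by (simp add: geodesics_def passage_time_Cons)
      also have "\<dots> \<le> \<omega> u + last_passage \<omega> (u + e1) v"
        using passage_time_le_last_passage[OF zq] \<open>z = u + e1\<close> by simp
      also have "\<dots> < last_passage \<omega> u v"
        using last_passage_rec[OF ne, of \<omega>] False by simp
      finally show False
        by simp
    qed
    with z False show ?thesis
      by simp
  qed
qed

lemma last_passage_shift:
  "last_passage (\<lambda>x. \<omega> (x + z)) u v = last_passage \<omega> (u + z) (v + z)"
proof -
  have step: "up_right_step (x + z) (y + z) = up_right_step x y" for x y
    by (auto simp: up_right_step_def algebra_simps)
  have succ: "successively up_right_step (map (\<lambda>x. x + z) p) = successively up_right_step p" for p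
    by (simp add: successively_map step)
  have fwd: "map (\<lambda>x. x + z) p \<in> finite_paths (u + z) (v + z)" if "p \<in> finite_paths u v" for p u v z
    using that by (auto simp: finite_paths_def successively_map hd_map last_map up_right_step_def
        algebra_simps elim!: successively_mono)
  have "finite_paths (u + z) (v + z) = map (\<lambda>x. x + z) ` finite_paths u v" (is "?L = ?R")
  proof
    show "?L \<subseteq> ?R"
    proof
      fix p assume "p \<in> ?L"
      from fwd[OF this, of "- z"] have "map (\<lambda>x. x + - z) p \<in> finite_paths u v"
        by simp
      moreover have "p = map (\<lambda>x. x + z) (map (\<lambda>x. x + - z) p)"
        by (simp add: o_def)
      ultimately show "p \<in> ?R"
        by blast
    qed
    show "?R \<subseteq> ?L"
      using fwd by blast
  qed
  moreover have "passage_time (\<lambda>x. \<omega> (x + z)) p = passage_time \<omega> (map (\<lambda>x. x + z) p)" for p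
    by (simp add: passage_time_def map_butlast[symmetric] o_def)
  ultimately show ?thesis
    by (simp add: last_passage_def image_image)
qed

section \<open>Semi-infinite geodesics and their Busemann functions\<close>

lemma level_path: "\<gamma> \<in> paths_from u \<Longrightarrow> level (\<gamma> n) = level u + int n"
proof (induction n)
  case (Suc n)
  then have "up_right_step (\<gamma> n) (\<gamma> (Suc n))"
    by (simp add: paths_from_def)
  with Suc level_step[OF this] show ?case
    by simp
qed (simp add: paths_from_def)

lemma passage_time_segment:
  "m \<le> n \<Longrightarrow> passage_time \<omega> (segment \<gamma> m n) = (\<Sum>i=m..<n. \<omega> (\<gamma> i))"
  by (simp add: passage_time_def segment_def map_butlast[symmetric] o_def
      interv_sum_list_conv_sum_set_nat)

lemma Geo_last_passage:
  assumes "\<gamma> \<in> Geo \<omega> u" "m \<le> n"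
  shows "last_passage \<omega> (\<gamma> m) (\<gamma> n) = (\<Sum>i=m..<n. \<omega> (\<gamma> i))" "finite_paths (\<gamma> m) (\<gamma> n) \<noteq> {}"
  using assms passage_time_segment[of m n \<omega> \<gamma>]
  by (auto simp: Geo_def rightmost_geodesic_def geodesics_def)

lemma coalesce_offsets:
  assumes "\<gamma> \<in> paths_from u" "\<rho> \<in> paths_from v" "coalesce \<gamma> \<rho>"
  obtains a b where "\<And>n. \<gamma> (a + n) = \<rho> (b + n)"
proof -
  obtain N where N: "\<And>m n. level (\<gamma> m) \<ge> N \<Longrightarrow> level (\<gamma> m) = level (\<rho> n) \<Longrightarrow> \<gamma> m = \<rho> n"
    using assms(3) unfolding coalesce_def by blast
  define l where "l = max N (max (level u) (level v))"
  have "\<gamma> (nat (l - level u) + n) = \<rho> (nat (l - level v) + n)" for n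
    by (rule N) (auto simp: level_path[OF assms(1)] level_path[OF assms(2)] l_def)
  then show ?thesis
    using that by blast
qed

text \<open>A deterministic version of a coalescing system, for one realisation of the weights.\<close>

locale coalescing_geodesics =
  fixes \<omega> :: "site \<Rightarrow> real" and \<rho> :: "site \<Rightarrow> nat \<Rightarrow> site"
  assumes geo: "\<rho> u \<in> Geo \<omega> u" and coal: "coalesce (\<rho> u) (\<rho> v)"
begin

lemma path: "\<rho> u \<in> paths_from u"
  using geo by (auto simp: Geo_def)

text \<open>The geodesic from \<open>x\<close> merges into the one from \<open>u\<close>. Hence passage times to far points of
  the latter are its own accumulated weight, up to a correction that depends only on \<open>x\<close>.\<close>

lemma last_passage_eventually:
  obtains c where "eventually (\<lambda>n. finite_paths x (\<rho> u n) \<noteq> {} \<and>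
    last_passage \<omega> x (\<rho> u n) = c + (\<Sum>i<n. \<omega> (\<rho> u i))) sequentially"
proof -
  obtain a b where ab: "\<And>n. \<rho> u (a + n) = \<rho> x (b + n)"
    using coalesce_offsets[OF path path coal] by metis
  define c where "c = (\<Sum>i<b. \<omega> (\<rho> x i)) - (\<Sum>i<a. \<omega> (\<rho> u i))"
  have x: "\<rho> x 0 = x"
    using path[of x] by (auto simp: paths_from_def)
  have "finite_paths x (\<rho> u n) \<noteq> {} \<and>
      last_passage \<omega> x (\<rho> u n) = c + (\<Sum>i<n. \<omega> (\<rho> u i))" if "a \<le> n" for n
  proof -
    define k where "k = n - a"
    have n: "n = a + k"
      using that by (simp add: k_def)
    have split: "(\<Sum>i<a + k. f i) = (\<Sum>i<a. f i) + (\<Sum>i<k. f (a + i))"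
      for a and f :: "nat \<Rightarrow> real"
      by (induction k) auto
    have "last_passage \<omega> x (\<rho> u n) = (\<Sum>i<b + k. \<omega> (\<rho> x i))"
      using Geo_last_passage(1)[OF geo[of x], of 0 "b + k"] x
      by (simp add: n ab atLeast0LessThan)
    also have "\<dots> = c + (\<Sum>i<n. \<omega> (\<rho> u i))"
      unfolding n split by (simp add: c_def ab)
    finally show ?thesis
      using Geo_last_passage(2)[OF geo[of x], of 0 "b + k"] x by (simp add: n ab)
  qed
  then show ?thesis
    by (intro that[of c]) (auto simp: eventually_sequentially)
qed

lemma busemann_eventually:
  "eventually (\<lambda>n. finite_paths x (\<rho> u n) \<noteq> {} \<and> finite_paths y (\<rho> u n) \<noteq> {} \<and>
    last_passage \<omega> x (\<rho> u n) - last_passage \<omega> y (\<rho> u n) = busemann \<omega> (\<rho> u) x y) sequentially"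
proof -
  obtain c where c: "eventually (\<lambda>n. finite_paths x (\<rho> u n) \<noteq> {} \<and>
      last_passage \<omega> x (\<rho> u n) = c + (\<Sum>i<n. \<omega> (\<rho> u i))) sequentially"
    by (rule last_passage_eventually)
  obtain d where d: "eventually (\<lambda>n. finite_paths y (\<rho> u n) \<noteq> {} \<and>
      last_passage \<omega> y (\<rho> u n) = d + (\<Sum>i<n. \<omega> (\<rho> u i))) sequentially"
    by (rule last_passage_eventually)
  have ev: "eventually (\<lambda>n. finite_paths x (\<rho> u n) \<noteq> {} \<and> finite_paths y (\<rho> u n) \<noteq> {} \<and>
      last_passage \<omega> x (\<rho> u n) - last_passage \<omega> y (\<rho> u n) = c - d) sequentially"
    using c d by eventually_elim auto
  then have "(\<lambda>n. last_passage \<omega> x (\<rho> u n) - last_passage \<omega> y (\<rho> u n)) \<longlonglongrightarrow> c - d"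
    by (intro tendsto_eventually) (auto elim: eventually_mono)
  then have "busemann \<omega> (\<rho> u) x y = c - d"
    unfolding busemann_def by (rule limI)
  with ev show ?thesis
    by simp
qed

lemma busemann_eqI:
  assumes "eventually (\<lambda>n. last_passage \<omega> x (\<rho> u n) - last_passage \<omega> y (\<rho> u n) = c) sequentially"
  shows "busemann \<omega> (\<rho> u) x y = c"
proof -
  have "eventually (\<lambda>n. busemann \<omega> (\<rho> u) x y = c) sequentially"
    using busemann_eventually[where x = x and y = y and u = u] assms by eventually_elim auto
  then show ?thesis
    by simp
qed

lemma busemann_cocycle: "cocycle (busemann \<omega> (\<rho> u))"
  unfolding cocycle_def
proof (intro allI)
  fix x y z
  have "eventually (\<lambda>n. last_passage \<omega> x (\<rho> u n) - last_passage \<omega> z (\<rho> u n) =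
      busemann \<omega> (\<rho> u) x y + busemann \<omega> (\<rho> u) y z) sequentially"
    using busemann_eventually[where x = x and y = y and u = u]
      busemann_eventually[where x = y and y = z and u = u]
    by eventually_elim auto
  from busemann_eqI[OF this]
  show "busemann \<omega> (\<rho> u) x y + busemann \<omega> (\<rho> u) y z = busemann \<omega> (\<rho> u) x z"
    by simp
qed

lemma busemann_recovers: "recovers (busemann \<omega> (\<rho> u)) \<omega>"
  unfolding recovers_def
proof
  fix x
  have "eventually (\<lambda>n. min (busemann \<omega> (\<rho> u) x (x + e1)) (busemann \<omega> (\<rho> u) x (x + e2)) = \<omega> x)
      sequentially"
    using busemann_eventually[where x = x and y = "x + e1" and u = u]
      busemann_eventually[where x = x and y = "x + e2" and u = u]
  proof eventually_elim
    case (elim n)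
    with last_passage_rec[of x "\<rho> u n" \<omega>] show ?case
      by (smt (verit, best))
  qed
  then show "min (busemann \<omega> (\<rho> u) x (x + e1)) (busemann \<omega> (\<rho> u) x (x + e2)) = \<omega> x"
    by simp
qed

text \<open>All geodesics of the system generate the same Busemann function.\<close>

lemma busemann_unique: "busemann \<omega> (\<rho> u) x y = busemann \<omega> (\<rho> v) x y"
proof -
  obtain a b where ab: "\<And>n. \<rho> u (a + n) = \<rho> v (b + n)"
    using coalesce_offsets[OF path path coal] by metis
  have "eventually (\<lambda>n. last_passage \<omega> x (\<rho> u (n + a)) - last_passage \<omega> y (\<rho> u (n + a)) =
      busemann \<omega> (\<rho> u) x y) sequentially"
    using busemann_eventually[where x = x and y = y and u = u]
    by (subst eventually_sequentially_seg) (auto elim: eventually_mono)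
  moreover have "eventually (\<lambda>n. last_passage \<omega> x (\<rho> v (n + b)) - last_passage \<omega> y (\<rho> v (n + b)) =
      busemann \<omega> (\<rho> v) x y) sequentially"
    using busemann_eventually[where x = x and y = y and u = v]
    by (subst eventually_sequentially_seg) (auto elim: eventually_mono)
  ultimately have "eventually (\<lambda>n::nat. busemann \<omega> (\<rho> u) x y = busemann \<omega> (\<rho> v) x y) sequentially"
    by eventually_elim (use ab in \<open>simp add: add.commute\<close>)
  then show ?thesis
    by simp
qed

theorem cocycle_path_busemann: "cocycle_path (busemann \<omega> (\<rho> u)) v = \<rho> v"
proof
  fix k
  define b where "b = busemann \<omega> (\<rho> v)"
  have b: "busemann \<omega> (\<rho> u) = b"
    unfolding b_def by (intro ext busemann_unique)
  show "cocycle_path (busemann \<omega> (\<rho> u)) v k = \<rho> v k"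
    unfolding b
  proof (induction k)
    case 0
    then show ?case
      using path[of v] by (simp add: paths_from_def)
  next
    case (Suc k)
    define x where "x = \<rho> v k"
    have "eventually (\<lambda>n. \<rho> v (Suc k) = (if b x (x + e1) \<le> b x (x + e2) then x + e1 else x + e2))
        sequentially"
      using busemann_eventually[where x = x and y = "x + e1" and u = v]
        busemann_eventually[where x = x and y = "x + e2" and u = v] eventually_gt_at_top[of k]
    proof eventually_elim
      case (elim n)
      have "rightmost_geodesic \<omega> x (\<rho> v n) (segment (\<rho> v) k n)"
        using geo[of v] elim by (auto simp: Geo_def x_def)
      moreover have "segment (\<rho> v) k n = x # \<rho> v (Suc k) # map (\<rho> v) [Suc (Suc k)..<Suc n]"
        using elim(3) by (simp add: segment_def x_def upt_conv_Cons del: upt_Suc)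
      ultimately show ?case
        using rightmost_first_step[of \<omega> x "\<rho> v n"] elim unfolding b_def
        by (smt (verit, best))
    qed
    then have "\<rho> v (Suc k) = (if b x (x + e1) \<le> b x (x + e2) then x + e1 else x + e2)"
      by simp
    then show ?case
      using Suc by (simp add: Let_def x_def)
  qed
qed

end

section \<open>Ergodic theory\<close>

text \<open>The maximal ergodic lemma for sums that are positive at some time almost surely, with
  Garsia's proof. The auxiliary function \<open>m N\<close> is the maximum of the first \<open>N\<close> ergodic sums
  of \<open>h\<close>, including the empty one.\<close>

lemma (in prob_space) maximal_ergodic_lemma:
  fixes h :: "'a \<Rightarrow> real"
  assumes S [measurable]: "S \<in> M \<rightarrow>\<^sub>M M" and pres: "distr M M S = M"
    and h: "integrable M h"
    and pos: "AE \<xi> in M. \<exists>n. 0 < (\<Sum>i<n. h ((S ^^ i) \<xi>))"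
  shows "0 \<le> expectation h"
proof -
  have h_meas [measurable]: "h \<in> borel_measurable M"
    using h by auto
  have int_S: "integrable M (\<lambda>\<xi>. f (S \<xi>))" "expectation (\<lambda>\<xi>. f (S \<xi>)) = expectation f"
    if "integrable M f" for f :: "'a \<Rightarrow> real"
    using integrable_distr_eq[of S M M f] integral_distr[of S M M f] that pres by auto
  define m where "m = rec_nat (\<lambda>\<xi>. 0) (\<lambda>N f \<xi>. max 0 (h \<xi> + f (S \<xi>)))"
  have m_0: "m 0 = (\<lambda>\<xi>. 0)" and m_Suc: "m (Suc N) = (\<lambda>\<xi>. max 0 (h \<xi> + m N (S \<xi>)))" for N
    by (simp_all add: m_def)
  have m_int: "integrable M (m N)" for N
  proof (induction N)
    case (Suc N)
    show ?case
      unfolding m_Suc using h int_S(1)[OF Suc]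
      by (intro integrable_max[where f = "\<lambda>_. 0"]) auto
  qed (simp add: m_0)
  have m_meas [measurable]: "m N \<in> borel_measurable M" for N
    using m_int by auto
  have m_nonneg: "0 \<le> m N \<xi>" for N \<xi>
    by (cases N) (auto simp: m_0 m_Suc)
  have m_mono: "m N \<xi> \<le> m (Suc N) \<xi>" for N \<xi>
  proof (induction N arbitrary: \<xi>)
    case (Suc N)
    show ?case
      unfolding m_Suc[of "Suc N"] m_Suc[of N]
      using Suc[of "S \<xi>"] by (simp add: m_Suc)
  qed (simp add: m_0 m_nonneg)
  have m_ge: "(\<Sum>i<n. h ((S ^^ i) \<xi>)) \<le> m n \<xi>" for n \<xi>
  proof (induction n arbitrary: \<xi>)
    case (Suc n)
    have "(\<Sum>i<Suc n. h ((S ^^ i) \<xi>)) = h \<xi> + (\<Sum>i<n. h ((S ^^ i) (S \<xi>)))"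
      by (subst sum.lessThan_Suc_shift) (simp del: funpow.simps add: funpow_Suc_right)
    then show ?case
      using Suc[of "S \<xi>"] by (simp add: m_Suc)
  qed (simp add: m_0)
  \<comment> \<open>Where \<open>m (Suc K)\<close> is positive, \<open>h\<close> equals \<open>m (Suc K) - m K \<circ> S\<close>.\<close>
  let ?I = "\<lambda>N \<xi>. indicator {\<xi>. 0 < m N \<xi>} \<xi> :: real"
  have nonneg: "0 \<le> expectation (\<lambda>\<xi>. h \<xi> * ?I N \<xi>)" for N
  proof (cases N)
    case (Suc K)
    have "0 \<le> expectation (m (Suc K)) - expectation (m K)"
      using integral_mono[OF m_int m_int m_mono] by simp
    also have "\<dots> = expectation (\<lambda>\<xi>. m (Suc K) \<xi> - m K (S \<xi>))"
      by (simp add: m_int int_S)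
    also have "\<dots> \<le> expectation (\<lambda>\<xi>. h \<xi> * ?I N \<xi>)"
    proof (rule integral_mono)
      show "integrable M (\<lambda>\<xi>. h \<xi> * ?I N \<xi>)"
        by (rule Bochner_Integration.integrable_bound[OF h]) (auto split: split_indicator)
      show "m (Suc K) \<xi> - m K (S \<xi>) \<le> h \<xi> * ?I N \<xi>" for \<xi>
        using m_nonneg[of K "S \<xi>"] by (auto simp: Suc m_Suc split: split_indicator)
    qed (intro Bochner_Integration.integrable_diff m_int int_S(1))
    finally show ?thesis .
  qed (simp add: m_0)
  have "(\<lambda>N. expectation (\<lambda>\<xi>. h \<xi> * ?I N \<xi>)) \<longlonglongrightarrow> expectation h"
  proof (rule integral_dominated_convergence[where w = "\<lambda>\<xi>. \<bar>h \<xi>\<bar>"])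
    show "AE \<xi> in M. (\<lambda>N. h \<xi> * ?I N \<xi>) \<longlonglongrightarrow> h \<xi>"
      using pos
    proof eventually_elim
      case (elim \<xi>)
      then obtain n where n: "0 < (\<Sum>i<n. h ((S ^^ i) \<xi>))"
        by auto
      have inc: "incseq (\<lambda>N. m N \<xi>)"
        by (rule incseq_SucI) (rule m_mono)
      have "0 < m n \<xi>"
        using n m_ge by (rule less_le_trans)
      then have "0 < m N \<xi>" if "n \<le> N" for N
        using incseqD[OF inc that] by linarith
      then have "eventually (\<lambda>N. h \<xi> * ?I N \<xi> = h \<xi>) sequentially"
        by (auto simp: eventually_sequentially intro!: exI[of _ n])
      then show ?case
        by (rule tendsto_eventually)
    qed
  qed (use h in \<open>auto split: split_indicator\<close>)
  then show ?thesis
    by (rule tendsto_lowerbound) (auto intro!: always_eventually nonneg)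
qed

lemma site_induct [case_names zero e1 e2 add minus]:
  fixes P :: "site \<Rightarrow> bool"
  assumes P: "P 0" "P e1" "P e2" and add: "\<And>x y. P x \<Longrightarrow> P y \<Longrightarrow> P (x + y)"
    and minus: "\<And>x. P x \<Longrightarrow> P (- x)"
  shows "P x"
proof -
  have nat: "P (int n, 0)" "P (0, int n)" for n
  proof (induction n)
    case (Suc n)
    show "P (int (Suc n), 0)" "P (0, int (Suc n))"
      using add[OF Suc(1) P(2)] add[OF Suc(2) P(3)]
      by (simp_all add: e1_def e2_def algebra_simps)
  qed (use P in \<open>simp_all add: zero_prod_def\<close>)
  have int: "P (a, 0)" "P (0, a)" for a
    using nat[of "nat a"] minus[OF nat(1)[of "nat (- a)"]] minus[OF nat(2)[of "nat (- a)"]]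
    by (cases "0 \<le> a"; simp)+
  show ?thesis
    using add[OF int(1)[of "fst x"] int(2)[of "snd x"]] by simp
qed

context extended_space
begin

lemma space_M [simp]: "space M = UNIV"
  using sets_eq_imp_space_eq[OF sets_M] by simp

lemma prob_UNIV [simp]: "prob UNIV = 1"
  using prob_space by simp

lemma Collect_events [measurable (raw)]: "Measurable.pred M P \<Longrightarrow> {\<xi>. P \<xi>} \<in> events"
  by (simp add: pred_def)

lemma T_measurable [measurable]: "T z \<in> M \<rightarrow>\<^sub>M M"
  using borel_measurable_continuous_onI[OF T_continuous[of z]]
  by (simp cong: measurable_cong_sets add: measurable_def sets_M)

declare w_measurable [measurable]

lemma T_T: "T x (T y \<xi>) = T (x + y) \<xi>"
  using T_add[of x y] by (auto simp: fun_eq_iff)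

lemma T_pow: "(T e1 ^^ n) \<xi> = T (int n, 0) \<xi>" "(T e2 ^^ n) \<xi> = T (0, int n) \<xi>"
  by (induction n) (auto simp: T_T T_zero[unfolded zero_prod_def] e1_def e2_def)

lemma AE_T:
  assumes "AE \<xi> in M. P \<xi>"
  shows "AE \<xi> in M. P (T z \<xi>)"
  by (rule AE_distrD[OF T_measurable]) (unfold T_invariant, fact assms)

lemma integral_T:
  fixes f :: "'a \<Rightarrow> real"
  assumes "f \<in> borel_measurable M"
  shows "integrable M (\<lambda>\<xi>. f (T z \<xi>)) \<longleftrightarrow> integrable M f"
    and "expectation (\<lambda>\<xi>. f (T z \<xi>)) = expectation f"
  using integrable_distr_eq[OF T_measurable assms, of z] integral_distr[OF T_measurable assms, of z]
    T_invariant by auto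

lemma prob_T:
  assumes "A \<in> sets M"
  shows "prob (T z -` A) = prob A"
  using measure_distr[OF T_measurable assms, of z] T_invariant by simp

text \<open>Since translations preserve the measure, an inclusion between an event and its translate
  up to a null set is an equality up to a null set. The points whose whole orbit stays in \<open>A\<close> form
  a strictly invariant version of \<open>A\<close>.\<close>

lemma ergodic_zero_one:
  assumes erg: "ergodic M T" and A [measurable]: "A \<in> sets M"
    and e1: "AE \<xi> in M. T e1 \<xi> \<in> A \<longrightarrow> \<xi> \<in> A"
    and e2: "AE \<xi> in M. T e2 \<xi> \<in> A \<longrightarrow> \<xi> \<in> A"
  shows "prob A \<in> {0, 1}"
proof -
  have vim [measurable]: "T z -` A \<in> sets M" for z
    using measurable_sets[OF T_measurable A, of z] by simp
  have step: "AE \<xi> in M. T z \<xi> \<in> A \<longleftrightarrow> \<xi> \<in> A" if "AE \<xi> in M. T z \<xi> \<in> A \<longrightarrow> \<xi> \<in> A" for z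
  proof -
    have "prob (A \<inter> T z -` A) = prob (T z -` A)"
      by (rule finite_measure_eq_AE) (use that in \<open>auto elim: eventually_mono\<close>)
    then have "prob (A - T z -` A) = 0"
      using finite_measure_Diff'[OF A vim[of z]] by (simp add: prob_T)
    then have "AE \<xi> in M. \<xi> \<notin> A - T z -` A"
      by (subst prob_eq_0[symmetric]) auto
    with that show ?thesis
      by eventually_elim auto
  qed
  have inv: "AE \<xi> in M. T x \<xi> \<in> A \<longleftrightarrow> \<xi> \<in> A" for x
  proof (induction x rule: site_induct)
    case (add x y)
    from AE_T[OF add(1), of y] add(2) show ?case
      by eventually_elim (simp add: T_T)
  next
    case (minus x)
    from AE_T[OF minus, of "- x"] show ?case
      by eventually_elim (simp add: T_T T_zero)
  qed (use step[OF e1] step[OF e2] in \<open>simp_all add: T_zero\<close>)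
  define H where "H = {\<xi>. \<forall>x. T x \<xi> \<in> A}"
  have [measurable]: "H \<in> sets M"
  proof -
    have "H = (\<Inter>x. T x -` A)"
      by (auto simp: H_def)
    then show ?thesis
      by auto
  qed
  have "T x ` H = H" for x
  proof
    show "T x ` H \<subseteq> H"
      unfolding H_def by (auto simp only: T_T)
    show "H \<subseteq> T x ` H"
    proof
      fix \<xi> assume "\<xi> \<in> H"
      then have "T (- x) \<xi> \<in> H"
        unfolding H_def by (auto simp only: T_T)
      moreover have "\<xi> = T x (T (- x) \<xi>)"
        by (simp add: T_T T_zero)
      ultimately show "\<xi> \<in> T x ` H"
        by blast
    qed
  qed
  with erg have "prob H \<in> {0, 1}"
    by (auto simp: ergodic_def)
  moreover have "prob H = prob A"
  proof (rule finite_measure_eq_AE)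
    have "AE \<xi> in M. \<forall>x. T x \<xi> \<in> A \<longleftrightarrow> \<xi> \<in> A"
      by (subst AE_all_countable) (use inv in auto)
    then show "AE \<xi> in M. \<xi> \<in> H \<longleftrightarrow> \<xi> \<in> A"
      by eventually_elim (auto simp: H_def)
  qed auto
  ultimately show ?thesis
    by simp
qed

end

section \<open>Reflection of the lattice\<close>

lemma (in prob_space) indep_vars_inj_reindex:
  assumes X: "indep_vars (\<lambda>_. N) X (f ` I)" and inj: "inj_on f I"
  shows "indep_vars (\<lambda>_. N) (\<lambda>i. X (f i)) I"
  unfolding indep_vars_def2 indep_sets_def
proof (intro conjI ballI allI impI)
  let ?F = "\<lambda>j. {X j -` A \<inter> space M |A. A \<in> sets N}"
  show "random_variable N (X (f i))" if "i \<in> I" for i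
    using X that by (auto simp: indep_vars_def2)
  then show "?F (f i) \<subseteq> events" if "i \<in> I" for i
    using that by (auto simp: measurable_sets)
  fix J A assume J: "J \<subseteq> I" "J \<noteq> {}" "finite J" and A: "A \<in> Pi J (\<lambda>i. ?F (f i))"
  have injJ: "inj_on f J"
    using inj J(1) by (rule inj_on_subset)
  define A' where "A' = A \<circ> the_inv_into J f"
  have A': "A' (f j) = A j" if "j \<in> J" for j
    using that by (simp add: A'_def the_inv_into_f_f[OF injJ])
  have "prob (\<Inter> (A' ` f ` J)) = (\<Prod>j\<in>f ` J. prob (A' j))"
  proof -
    have "f ` J \<subseteq> f ` I" "f ` J \<noteq> {}" "finite (f ` J)"
      using J by auto
    moreover have "A' \<in> Pi (f ` J) ?F"
      using A A' by (auto simp: Pi_iff)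
    ultimately show ?thesis
      using X unfolding indep_vars_def2 indep_sets_def by blast
  qed
  moreover have "A' ` f ` J = A ` J"
    using A' by (auto simp: image_image)
  ultimately show "prob (\<Inter> (A ` J)) = (\<Prod>j\<in>J. prob (A j))"
    using A' by (simp add: prod.reindex[OF injJ])
qed

lemma swap_add: "prod.swap (x + y) = prod.swap x + prod.swap y" for x y :: site
  by (cases x; cases y) simp

lemma swap_unit [simp]: "prod.swap e1 = e2" "prod.swap e2 = e1" "prod.swap (0::site) = 0"
  by (simp_all add: e1_def e2_def zero_prod_def)

text \<open>The hypotheses are symmetric in the two coordinates, so that integrability of the increments
  in direction \<open>e2\<close> will follow from that in direction \<open>e1\<close>.\<close>

lemma (in extended_space) extended_space_swap:
  "extended_space M (\<lambda>z. T (prod.swap z)) (\<lambda>x. w (prod.swap x))"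
proof unfold_locales
  show "indep_vars (\<lambda>_. borel) (\<lambda>x. w (prod.swap x)) UNIV"
    by (rule indep_vars_inj_reindex) (use w_indep in \<open>simp_all add: surj_swap\<close>)
qed (use sets_M T_zero T_add T_bij T_continuous T_invariant w_measurable w_shift w_identical
    w_moment w_variance in \<open>simp_all add: swap_add\<close>)

lemma ergodic_swap:
  assumes "ergodic M T"
  shows "ergodic M (\<lambda>z. T (prod.swap z))"
  unfolding ergodic_def
proof (intro ballI impI)
  fix H assume H: "H \<in> sets M" "\<forall>x. T (prod.swap x) ` H = H"
  have "T x ` H = H" for x
    using H(2)[rule_format, of "prod.swap x"] by simp
  with assms H(1) show "measure M H \<in> {0, 1}"
    by (auto simp: ergodic_def)
qed

section \<open>Counting chains\<close>

text \<open>The coordinatewise order of the quadrant.\<close>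

definition below :: "nat \<times> nat \<Rightarrow> nat \<times> nat \<Rightarrow> bool" where
  "below x y \<longleftrightarrow> fst x \<le> fst y \<and> snd x \<le> snd y"

text \<open>The points \<open>below\<close> \<open>(a, b)\<close> other than \<open>(a, b)\<close> itself.\<close>

definition punctured_box :: "nat \<Rightarrow> nat \<Rightarrow> (nat \<times> nat) set" where
  "punctured_box a b = {..a} \<times> {..b} - {(a, b)}"

text \<open>All totally ordered subsets of a punctured box, the empty one included.\<close>

definition chains_in :: "nat \<Rightarrow> nat \<Rightarrow> (nat \<times> nat) set set" where
  "chains_in a b = {A. A \<subseteq> punctured_box a b \<and> (\<forall>x\<in>A. \<forall>y\<in>A. below x y \<or> below y x)}"

lemma finite_punctured_box [simp]: "finite (punctured_box a b)"
  by (simp add: punctured_box_def)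

lemma finite_chains_in [simp]: "finite (chains_in a b)"
  by (rule finite_subset[of _ "Pow (punctured_box a b)"]) (auto simp: chains_in_def)

lemma finite_chain: "A \<in> chains_in a b \<Longrightarrow> finite A"
  by (auto simp: chains_in_def intro: finite_subset)

lemma chain_remove_max:
  assumes A: "A \<in> chains_in a b" "A \<noteq> {}"
  obtains q B where "q \<in> punctured_box a b" "B \<in> chains_in (fst q) (snd q)" "A = insert q B"
proof -
  have fin: "finite A"
    using A(1) by (rule finite_chain)
  let ?f = "\<lambda>x :: nat \<times> nat. fst x + snd x"
  have "Max (?f ` A) \<in> ?f ` A"
    using fin A by (intro Max_in) auto
  then obtain q where q: "q \<in> A" "?f q = Max (?f ` A)"
    by auto
  have "?f x \<le> ?f q" if "x \<in> A" for x
    using that fin by (simp only: q(2)) auto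
  then have q_le: "?f x \<le> ?f q" if "x \<in> A" for x
    using that by blast
  have q_max: "below x q" if "x \<in> A" for x
  proof -
    have "below x q \<or> below q x"
      using A(1) q(1) that by (auto simp: chains_in_def)
    moreover have "x = q" if "below q x"
      using that q_le[OF \<open>x \<in> A\<close>] by (auto simp: below_def prod_eq_iff)
    ultimately show ?thesis
      by (auto simp: below_def)
  qed
  have "A - {q} \<in> chains_in (fst q) (snd q)"
    unfolding chains_in_def
  proof (intro CollectI conjI subsetI)
    show "x \<in> punctured_box (fst q) (snd q)" if "x \<in> A - {q}" for x
      using that q_max[of x] by (cases x; cases q) (auto simp: punctured_box_def below_def)
    show "\<forall>x\<in>A - {q}. \<forall>y\<in>A - {q}. below x y \<or> below y x"
      using A(1) by (auto simp: chains_in_def)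
  qed
  then show ?thesis
    using q(1) A(1) by (intro that[of q "A - {q}"]) (auto simp: chains_in_def)
qed

text \<open>Splitting off the maximal point of a chain bounds the generating function of a box by a sum
  of those of the smaller boxes. The function \<open>(1 / (1 - r)) ^ (a + b)\<close> is a supersolution of the
  resulting recursion.\<close>

lemma chains_generating_function:
  fixes r :: real
  assumes r: "0 \<le> r" "r < 1"
  shows "(\<Sum>A\<in>chains_in a b. (r\<^sup>2) ^ card A) \<le> (1 / (1 - r)) ^ (a + b)"
proof (induction "a + b" arbitrary: a b rule: less_induct)
  case less
  define l where "l = 1 / (1 - r)"
  have l: "l * (1 - r) = 1" "1 \<le> l"
    using r by (auto simp: l_def field_simps)
  have geometric: "r * (\<Sum>i\<le>n. l ^ i) = l ^ n - (1 - r)" for n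
  proof (induction n)
    case (Suc n)
    have "l ^ n = (l * (1 - r)) * l ^ n"
      by (simp add: l(1))
    with Suc show ?case
      by (simp add: algebra_simps)
  qed simp
  have "(\<Sum>A\<in>chains_in a b - {{}}. (r\<^sup>2) ^ card A) \<le>
      (\<Sum>(q, B)\<in>(SIGMA q:punctured_box a b. chains_in (fst q) (snd q)). r\<^sup>2 * (r\<^sup>2) ^ card B)"
  proof (rule sum_le_included[where i = "\<lambda>(q, B). insert q B"])
    show "\<forall>A\<in>chains_in a b - {{}}.
        \<exists>y\<in>SIGMA q:punctured_box a b. chains_in (fst q) (snd q). (case y of (q, B) \<Rightarrow> insert q B) = A \<and>
          (r\<^sup>2) ^ card A \<le> (case y of (q, B) \<Rightarrow> r\<^sup>2 * (r\<^sup>2) ^ card B)"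
    proof
      fix A assume "A \<in> chains_in a b - {{}}"
      then obtain q B where B: "q \<in> punctured_box a b" "B \<in> chains_in (fst q) (snd q)" "A = insert q B"
        using chain_remove_max[of A a b] by blast
      then have "q \<notin> B"
        by (auto simp: chains_in_def punctured_box_def)
      with B have "card A = Suc (card B)"
        using finite_chain[OF B(2)] by simp
      with B show "\<exists>y\<in>SIGMA q:punctured_box a b. chains_in (fst q) (snd q).
          (case y of (q, B) \<Rightarrow> insert q B) = A \<and>
          (r\<^sup>2) ^ card A \<le> (case y of (q, B) \<Rightarrow> r\<^sup>2 * (r\<^sup>2) ^ card B)"
        by (intro bexI[of _ "(q, B)"]) auto
    qed
  qed (auto intro!: mult_nonneg_nonneg)
  also have "\<dots> = (\<Sum>q\<in>punctured_box a b. \<Sum>B\<in>chains_in (fst q) (snd q). r\<^sup>2 * (r\<^sup>2) ^ card B)"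
    by (rule sum.Sigma[symmetric]) auto
  also have "\<dots> \<le> (\<Sum>q\<in>punctured_box a b. r\<^sup>2 * l ^ (fst q + snd q))"
  proof (rule sum_mono)
    fix q assume "q \<in> punctured_box a b"
    then have "fst q + snd q < a + b"
      by (cases q) (auto simp: punctured_box_def)
    then show "(\<Sum>B\<in>chains_in (fst q) (snd q). r\<^sup>2 * (r\<^sup>2) ^ card B) \<le> r\<^sup>2 * l ^ (fst q + snd q)"
      using less by (simp add: sum_distrib_left[symmetric] l_def mult_left_mono)
  qed
  also have "\<dots> = (\<Sum>q\<in>{..a} \<times> {..b}. r\<^sup>2 * l ^ (fst q + snd q)) - r\<^sup>2 * l ^ (a + b)"
    by (simp add: punctured_box_def sum_diff)
  also have "(\<Sum>q\<in>{..a} \<times> {..b}. r\<^sup>2 * l ^ (fst q + snd q)) =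
      (r * (\<Sum>i\<le>a. l ^ i)) * (r * (\<Sum>i\<le>b. l ^ i))"
  proof -
    have "(r * (\<Sum>i\<le>a. l ^ i)) * (r * (\<Sum>i\<le>b. l ^ i)) =
        r\<^sup>2 * ((\<Sum>i\<le>a. l ^ i) * (\<Sum>i\<le>b. l ^ i))"
      by (simp add: power2_eq_square)
    also have "(\<Sum>i\<le>a. l ^ i) * (\<Sum>i\<le>b. l ^ i) = (\<Sum>q\<in>{..a} \<times> {..b}. l ^ (fst q + snd q))"
      by (simp add: sum_product sum.cartesian_product power_add case_prod_beta)
    finally show ?thesis
      by (simp add: sum_distrib_left)
  qed
  also have "\<dots> = (l ^ a - (1 - r)) * (l ^ b - (1 - r))"
    by (simp only: geometric)
  finally have "(\<Sum>A\<in>chains_in a b - {{}}. (r\<^sup>2) ^ card A) \<le>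
      (l ^ a - (1 - r)) * (l ^ b - (1 - r)) - r\<^sup>2 * l ^ (a + b)" .
  moreover have "(\<Sum>A\<in>chains_in a b. (r\<^sup>2) ^ card A) =
      1 + (\<Sum>A\<in>chains_in a b - {{}}. (r\<^sup>2) ^ card A)"
    by (subst sum.remove[of _ "{}"]) (auto simp: chains_in_def)
  moreover have "1 + (x - (1 - r)) * (y - (1 - r)) - r\<^sup>2 * (x * y) \<le> x * y" if "1 \<le> x" "1 \<le> y" for x y
  proof -
    have "r\<^sup>2 * 1 \<le> r\<^sup>2 * (x * y)"
      using that mult_mono[of 1 x 1 y] by (intro mult_left_mono) auto
    moreover have "(1 - r) * 2 \<le> (1 - r) * (x + y)"
      using that r by (intro mult_left_mono) auto
    ultimately show ?thesis
      by (simp add: power2_eq_square algebra_simps)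
  qed
  from this[of "l ^ a" "l ^ b"] have
    "1 + (l ^ a - (1 - r)) * (l ^ b - (1 - r)) - r\<^sup>2 * l ^ (a + b) \<le> l ^ (a + b)"
    using l by (simp add: power_add)
  ultimately show ?case
    unfolding l_def[symmetric] by linarith
qed

section \<open>Random weights along all paths\<close>

lemma path_from_zero:
  assumes "\<gamma> \<in> paths_from 0"
  shows "0 \<le> fst (\<gamma> i)" "0 \<le> snd (\<gamma> i)" "fst (\<gamma> i) + snd (\<gamma> i) = int i"
proof -
  have step: "\<gamma> 0 = 0" "up_right_step (\<gamma> i) (\<gamma> (Suc i))" for i
    using assms by (auto simp: paths_from_def)
  have "0 \<le> fst (\<gamma> i) \<and> 0 \<le> snd (\<gamma> i)"
  proof (induction i)
    case (Suc i)
    with step(2)[of i] show ?case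
      by (auto simp: up_right_step_def e1_def e2_def)
  qed (simp add: step)
  then show "0 \<le> fst (\<gamma> i)" "0 \<le> snd (\<gamma> i)"
    by auto
  show "fst (\<gamma> i) + snd (\<gamma> i) = int i"
    using level_path[OF assms, of i] by (simp add: level_def)
qed

lemma path_mono:
  assumes "\<gamma> \<in> paths_from u" "i \<le> j"
  shows "fst (\<gamma> i) \<le> fst (\<gamma> j)" "snd (\<gamma> i) \<le> snd (\<gamma> j)"
proof -
  have step: "up_right_step (\<gamma> i) (\<gamma> (Suc i))" for i
    using assms by (auto simp: paths_from_def)
  have "fst (\<gamma> i) \<le> fst (\<gamma> (Suc i))" for i
    using step[of i] by (auto simp: up_right_step_def e1_def e2_def)
  from lift_Suc_mono_le[of "\<lambda>i. fst (\<gamma> i)", OF this assms(2)]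
  show "fst (\<gamma> i) \<le> fst (\<gamma> j)" .
  have "snd (\<gamma> i) \<le> snd (\<gamma> (Suc i))" for i
    using step[of i] by (auto simp: up_right_step_def e1_def e2_def)
  from lift_Suc_mono_le[of "\<lambda>i. snd (\<gamma> i)", OF this assms(2)]
  show "snd (\<gamma> i) \<le> snd (\<gamma> j)" .
qed

text \<open>The inclusion of the quadrant, on which chains are counted, into the lattice.\<close>

definition of_nat_site :: "nat \<times> nat \<Rightarrow> site" where
  "of_nat_site x = (int (fst x), int (snd x))"

lemma inj_of_nat_site: "inj of_nat_site"
  by (auto simp: inj_on_def of_nat_site_def prod_eq_iff)

context extended_space
begin

text \<open>All weights have the same distribution.\<close>

lemma w_cong:
  assumes [measurable]: "f \<in> borel_measurable borel"
  shows "expectation (\<lambda>\<xi>. f (w x \<xi>)) = expectation (\<lambda>\<xi>. f (w 0 \<xi>) :: real)"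
    and "integrable M (\<lambda>\<xi>. f (w x \<xi>)) \<longleftrightarrow> integrable M (\<lambda>\<xi>. f (w 0 \<xi>) :: real)"
proof -
  have "expectation (\<lambda>\<xi>. f (w x \<xi>)) = integral\<^sup>L (distr M borel (w x)) f"
    by (rule integral_distr[symmetric]) auto
  also have "\<dots> = expectation (\<lambda>\<xi>. f (w 0 \<xi>))"
    unfolding w_identical[of x] by (rule integral_distr) auto
  finally show "expectation (\<lambda>\<xi>. f (w x \<xi>)) = expectation (\<lambda>\<xi>. f (w 0 \<xi>))" .
  have "integrable M (\<lambda>\<xi>. f (w x \<xi>)) = integrable (distr M borel (w x)) f"
    by (rule integrable_distr_eq[symmetric]) auto
  also have "\<dots> = integrable M (\<lambda>\<xi>. f (w 0 \<xi>))"
    unfolding w_identical[of x] by (rule integrable_distr_eq) auto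
  finally show "integrable M (\<lambda>\<xi>. f (w x \<xi>)) = integrable M (\<lambda>\<xi>. f (w 0 \<xi>))" .
qed

text \<open>Independence, in the form in which the counts of chains and the exponential moments use it.\<close>

lemma expectation_prod_sites:
  fixes f :: "real \<Rightarrow> real" and s :: "'i \<Rightarrow> site"
  assumes f [measurable]: "f \<in> borel_measurable borel" and bd: "\<And>t. \<bar>f t\<bar> \<le> c"
    and fin: "finite I" and inj: "inj_on s I"
  shows "integrable M (\<lambda>\<xi>. \<Prod>i\<in>I. f (w (s i) \<xi>))"
    and "expectation (\<lambda>\<xi>. \<Prod>i\<in>I. f (w (s i) \<xi>)) = expectation (\<lambda>\<xi>. f (w 0 \<xi>)) ^ card I"
proof -
  have int: "integrable M (\<lambda>\<xi>. f (w x \<xi>))" for x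
  proof (rule integrable_const_bound[of _ c])
    show "AE \<xi> in M. norm (f (w x \<xi>)) \<le> c"
      using bd by (intro AE_I2) simp
  qed measurable
  have "indep_vars (\<lambda>_. borel) w (s ` I)"
    by (rule indep_vars_subset[OF w_indep]) (rule subset_UNIV)
  then have "indep_vars (\<lambda>_. borel) (\<lambda>x \<xi>. f (w x \<xi>)) (s ` I)"
    by (rule indep_vars_compose2[where Y = "\<lambda>_. f"]) (rule f)
  from indep_vars_inj_reindex[OF this inj]
  have ind: "indep_vars (\<lambda>_. borel) (\<lambda>i \<xi>. f (w (s i) \<xi>)) I" .
  show "integrable M (\<lambda>\<xi>. \<Prod>i\<in>I. f (w (s i) \<xi>))"
    by (rule indep_vars_integrable[OF fin ind]) (rule int)
  show "expectation (\<lambda>\<xi>. \<Prod>i\<in>I. f (w (s i) \<xi>)) = expectation (\<lambda>\<xi>. f (w 0 \<xi>)) ^ card I"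
  proof -
    have "expectation (\<lambda>\<xi>. \<Prod>i\<in>I. f (w (s i) \<xi>)) = (\<Prod>i\<in>I. expectation (\<lambda>\<xi>. f (w (s i) \<xi>)))"
      by (rule indep_vars_lebesgue_integral[OF fin ind int])
    also have "\<dots> = (\<Prod>i\<in>I. expectation (\<lambda>\<xi>. f (w 0 \<xi>)))"
      by (intro prod.cong refl w_cong(1) f)
    finally show ?thesis
      by simp
  qed
qed

text \<open>Sites whose weight exceeds \<open>a\<close> in absolute value are marked. The marked sites of a path form a
  chain, and so do all their subsets. Hence \<open>2 ^ N\<close> is at most the number of chains of marked sites
  in a box, if a path of \<open>k\<close> sites has \<open>N\<close> marked ones.\<close>

lemma marked_sites_on_paths:
  fixes a r :: real
  assumes p: "prob {\<xi>. a < \<bar>w 0 \<xi>\<bar>} = r\<^sup>2" and r: "0 \<le> r" "r \<le> 1 / 2"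
  obtains Y where "Y \<in> borel_measurable M" "\<And>\<xi>. 0 \<le> Y \<xi>" "integrable M Y"
    "expectation Y \<le> 8 * real k * r"
    "\<And>\<xi> \<gamma>. \<gamma> \<in> paths_from 0 \<Longrightarrow> real (card {i. i < k \<and> a < \<bar>w (\<gamma> i) \<xi>\<bar>}) \<le> Y \<xi>"
proof -
  define f :: "real \<Rightarrow> real" where "f = indicator {t. a < \<bar>t\<bar>}"
  have f_meas [measurable]: "f \<in> borel_measurable borel"
    unfolding f_def by simp
  have f_bd: "\<bar>f t\<bar> \<le> 1" for t
    by (simp add: f_def split: split_indicator)
  define P where "P A \<xi> = (\<Prod>x\<in>A. f (w (of_nat_site x) \<xi>))" for A \<xi>
  define U where "U \<xi> = (\<Sum>A\<in>chains_in k k. P A \<xi>)" for \<xi>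
  have P_nonneg: "0 \<le> P A \<xi>" for A \<xi>
    by (auto simp: P_def f_def intro!: prod_nonneg)
  have "expectation (\<lambda>\<xi>. f (w 0 \<xi>)) = expectation (indicator {\<xi>. a < \<bar>w 0 \<xi>\<bar>})"
    by (intro Bochner_Integration.integral_cong) (auto simp: f_def split: split_indicator)
  then have f_exp: "expectation (\<lambda>\<xi>. f (w 0 \<xi>)) = r\<^sup>2"
    using p by simp
  have P: "integrable M (P A)" "expectation (P A) = (r\<^sup>2) ^ card A" if "A \<in> chains_in k k" for A
    unfolding P_def
    using expectation_prod_sites[OF f_meas f_bd finite_chain[OF that] inj_on_subset[OF inj_of_nat_site]]
    by (simp_all add: f_exp)
  have U_int: "integrable M U"
    unfolding U_def using P by auto
  have [measurable]: "U \<in> borel_measurable M"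
    using U_int by auto
  define c where "c = (1 / (1 - r)) ^ (k + k)"
  have c: "0 < c" "expectation U \<le> c"
  proof -
    have "expectation U = (\<Sum>A\<in>chains_in k k. (r\<^sup>2) ^ card A)"
      unfolding U_def using P by (simp add: Bochner_Integration.integral_sum)
    then show "expectation U \<le> c"
      unfolding c_def using chains_generating_function[of r k k] r by simp
    show "0 < c"
      using r by (simp add: c_def)
  qed
  have U_ge_1: "1 \<le> U \<xi>" for \<xi>
  proof -
    have "P {} \<xi> \<le> U \<xi>"
      unfolding U_def by (rule member_le_sum) (auto simp: chains_in_def P_nonneg)
    then show ?thesis
      by (simp add: P_def)
  qed
  \<comment> \<open>The tangent to the logarithm at \<open>c\<close> gives Jensen's inequality.\<close>
  have ln_U: "ln (U \<xi>) \<le> ln c + U \<xi> / c - 1" for \<xi>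
    using ln_le_minus_one[of "U \<xi> / c"] U_ge_1[of \<xi>] c(1) by (simp add: ln_div)
  have ln_int: "integrable M (\<lambda>\<xi>. ln (U \<xi>))"
  proof (rule Bochner_Integration.integrable_bound[OF U_int])
    show "AE \<xi> in M. norm (ln (U \<xi>)) \<le> norm (U \<xi>)"
    proof (intro AE_I2)
      show "norm (ln (U \<xi>)) \<le> norm (U \<xi>)" for \<xi>
        using U_ge_1[of \<xi>] ln_bound[of "U \<xi>"] by simp
    qed
  qed auto
  have "expectation (\<lambda>\<xi>. ln (U \<xi>)) \<le> expectation (\<lambda>\<xi>. ln c + U \<xi> / c - 1)"
    by (intro integral_mono ln_int ln_U) (use U_int in auto)
  also have "\<dots> = ln c + expectation U / c - 1"
    using U_int by (simp add: prob_space)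
  also have "\<dots> \<le> ln c"
    using c by simp
  also have "ln c = - (2 * real k * ln (1 - r))"
    using r by (simp add: c_def ln_realpow ln_div)
  also have "\<dots> \<le> 2 * real k * (2 * r)"
  proof -
    have "- r - 2 * r\<^sup>2 \<le> ln (1 - r)"
      using r by (intro ln_one_minus_pos_lower_bound)
    moreover have "r * r \<le> r * (1 / 2)"
      using r by (intro mult_left_mono)
    ultimately have "- ln (1 - r) \<le> 2 * r"
      by (simp add: power2_eq_square)
    then have "2 * real k * (- ln (1 - r)) \<le> 2 * real k * (2 * r)"
      by (intro mult_left_mono) auto
    then show ?thesis
      by (simp only: mult_minus_right)
  qed
  finally have exp_ln: "expectation (\<lambda>\<xi>. ln (U \<xi>)) \<le> 4 * real k * r"
    by simp
  have ln2: "1 / 2 \<le> ln (2::real)"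
    using ln_le_minus_one[of "1 / 2 :: real"] by (simp add: ln_div)
  define Y where "Y \<xi> = 2 * ln (U \<xi>)" for \<xi>
  show ?thesis
  proof (rule that[of Y])
    show "Y \<in> borel_measurable M" "integrable M Y"
      using ln_int by (auto simp: Y_def[abs_def])
    show "0 \<le> Y \<xi>" for \<xi>
      using U_ge_1 by (simp add: Y_def)
    show "expectation Y \<le> 8 * real k * r"
      using exp_ln by (simp add: Y_def[abs_def] mult.commute)
    fix \<xi> \<gamma> assume \<gamma>: "\<gamma> \<in> paths_from 0"
    define s where "s i = (nat (fst (\<gamma> i)), nat (snd (\<gamma> i)))" for i
    have s: "of_nat_site (s i) = \<gamma> i" for i
      using path_from_zero[OF \<gamma>, of i] by (simp add: s_def of_nat_site_def)
    have s_sum: "fst (s i) + snd (s i) = i" for i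
      using path_from_zero[OF \<gamma>, of i] by (simp add: s_def)
    have s_mono: "below (s i) (s j)" if "i \<le> j" for i j
      using path_mono[OF \<gamma> that] by (simp add: below_def s_def nat_mono)
    define m where "m = s ` {i. i < k \<and> a < \<bar>w (\<gamma> i) \<xi>\<bar>}"
    have "inj s"
      by (rule inj_on_inverseI[where g = "\<lambda>x. fst x + snd x"]) (simp add: s_sum)
    then have card_m: "card m = card {i. i < k \<and> a < \<bar>w (\<gamma> i) \<xi>\<bar>}"
      unfolding m_def by (intro card_image) (auto intro: inj_on_subset)
    have fin_m: "finite m"
      by (simp add: m_def)
    have "m \<subseteq> punctured_box k k"
    proof
      fix x assume "x \<in> m"
      then obtain i where "i < k" "x = s i"
        by (auto simp: m_def)
      with s_sum[of i] show "x \<in> punctured_box k k"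
        by (cases "s i") (auto simp: punctured_box_def)
    qed
    moreover have "\<forall>x\<in>m. \<forall>y\<in>m. below x y \<or> below y x"
    proof (intro ballI)
      fix x y assume "x \<in> m" "y \<in> m"
      then obtain i j where "x = s i" "y = s j"
        by (auto simp: m_def)
      then show "below x y \<or> below y x"
        using s_mono[of i j] s_mono[of j i] by (cases "i \<le> j") auto
    qed
    ultimately have sub: "Pow m \<subseteq> chains_in k k"
      by (auto simp: chains_in_def)
    have P1: "P A \<xi> = 1" if "A \<in> Pow m" for A
      unfolding P_def using that by (intro prod.neutral) (auto simp: m_def f_def s)
    have "2 ^ card m = (\<Sum>A\<in>Pow m. P A \<xi>)"
      by (simp add: P1 card_Pow fin_m)
    also have "\<dots> \<le> U \<xi>"
      unfolding U_def by (rule sum_mono2) (use sub P_nonneg in auto)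
    finally have "ln (2 ^ card m) \<le> ln (U \<xi>)"
      by (intro ln_mono) auto
    then have "real (card m) * ln 2 \<le> ln (U \<xi>)"
      by (simp add: ln_realpow)
    moreover have "real (card m) * (1 / 2) \<le> real (card m) * ln 2"
      using ln2 by (intro mult_left_mono) auto
    ultimately show "real (card {i. i < k \<and> a < \<bar>w (\<gamma> i) \<xi>\<bar>}) \<le> Y \<xi>"
      by (simp add: card_m Y_def)
  qed
qed

lemma prob_exceed:
  obtains C q :: real where "2 < q" "0 \<le> C" "\<And>t. 0 < t \<Longrightarrow> prob {\<xi>. t < \<bar>w 0 \<xi>\<bar>} \<le> C * t powr (- q)"
proof -
  obtain e where e: "0 < e" "integrable M (\<lambda>\<xi>. \<bar>w 0 \<xi>\<bar> powr (2 + e))"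
    using w_moment by auto
  show ?thesis
  proof (rule that[of "2 + e" "expectation (\<lambda>\<xi>. \<bar>w 0 \<xi>\<bar> powr (2 + e))"])
    fix t :: real assume t: "0 < t"
    have "prob {\<xi>. t < \<bar>w 0 \<xi>\<bar>} \<le> prob {\<xi>\<in>space M. t powr (2 + e) \<le> \<bar>w 0 \<xi>\<bar> powr (2 + e)}"
      using t e(1) by (intro finite_measure_mono) (auto intro!: powr_mono2)
    also have "\<dots> \<le> expectation (\<lambda>\<xi>. \<bar>w 0 \<xi>\<bar> powr (2 + e)) / t powr (2 + e)"
      by (rule integral_Markov_inequality_measure[OF e(2)]) (use t in auto)
    finally show "prob {\<xi>. t < \<bar>w 0 \<xi>\<bar>} \<le> expectation (\<lambda>\<xi>. \<bar>w 0 \<xi>\<bar> powr (2 + e)) * t powr (- (2 + e))"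
      by (simp only: powr_minus_divide) simp
  qed (use e in auto)
qed

lemma w_square_integrable: "integrable M (\<lambda>\<xi>. (w x \<xi>)\<^sup>2)"
proof -
  obtain e where e: "0 < e" "integrable M (\<lambda>\<xi>. \<bar>w 0 \<xi>\<bar> powr (2 + e))"
    using w_moment by auto
  have "integrable M (\<lambda>\<xi>. 1 + \<bar>w 0 \<xi>\<bar> powr (2 + e))"
    using e by auto
  then have "integrable M (\<lambda>\<xi>. (w 0 \<xi>)\<^sup>2)"
  proof (rule Bochner_Integration.integrable_bound)
    show "AE \<xi> in M. norm ((w 0 \<xi>)\<^sup>2) \<le> norm (1 + \<bar>w 0 \<xi>\<bar> powr (2 + e))"
    proof (rule AE_I2)
      fix \<xi>
      define v where "v = \<bar>w 0 \<xi>\<bar>"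
      have v: "0 \<le> v" "norm ((w 0 \<xi>)\<^sup>2) = v\<^sup>2"
        by (simp_all add: v_def)
      show "norm ((w 0 \<xi>)\<^sup>2) \<le> norm (1 + \<bar>w 0 \<xi>\<bar> powr (2 + e))"
        unfolding v(2) v_def[symmetric]
      proof (cases "v \<le> 1")
        case True
        then have "v\<^sup>2 \<le> 1"
          using v(1) by (intro power_le_one)
        then show "v\<^sup>2 \<le> norm (1 + v powr (2 + e))"
          using powr_ge_zero[of v "2 + e"] unfolding real_norm_def by linarith
      next
        case False
        then have "v powr 2 \<le> v powr (2 + e)"
          using e(1) by (intro powr_mono) auto
        then show "v\<^sup>2 \<le> norm (1 + v powr (2 + e))"
          using False powr_ge_zero[of v "2 + e"] by (simp add: powr_numeral)
      qed
    qed
  qed auto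
  then show ?thesis
    using w_cong(2)[of "\<lambda>t. t\<^sup>2" x] by simp
qed

lemma w_integrable: "integrable M (w x)"
  by (rule square_integrable_imp_integrable) (auto intro: w_square_integrable)

text \<open>The number of sites whose weight exceeds \<open>j\<close> in absolute value on a path of length \<open>k\<close> is at
  most of order \<open>k\<close> times the square root of their density, which is summable over \<open>j\<close> thanks to
  the moment assumption.\<close>

lemma tail_on_paths:
  fixes t h :: real
  assumes t: "0 < t" and h: "0 < h"
  obtains K :: nat where "\<And>k. \<exists>G\<in>sets M. 1 - h \<le> prob G \<and>
    (\<forall>\<xi>\<in>G. \<forall>\<gamma>\<in>paths_from 0. (\<Sum>i<k. max 0 (\<bar>w (\<gamma> i) \<xi>\<bar> - real K)) \<le> t * real k)"
proof -
  obtain C q :: real where C: "2 < q" "0 \<le> C"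
    "\<And>t. 0 < t \<Longrightarrow> prob {\<xi>. t < \<bar>w 0 \<xi>\<bar>} \<le> C * t powr (- q)"
    by (rule prob_exceed) blast
  define r where "r j = sqrt (prob {\<xi>. real j < \<bar>w 0 \<xi>\<bar>})" for j
  have r_nonneg: "0 \<le> r j" for j
    by (simp add: r_def)
  have r_le: "r j \<le> sqrt C * real j powr (- q / 2)" if "0 < j" for j
  proof -
    have "r j \<le> sqrt (C * real j powr (- q))"
      unfolding r_def using C(3)[of "real j"] that by (intro real_sqrt_le_mono) auto
    also have "\<dots> = sqrt C * real j powr (- q / 2)"
      by (simp add: real_sqrt_mult powr_half_sqrt[symmetric] powr_powr)
    finally show ?thesis .
  qed
  have "summable (\<lambda>j. sqrt C * real j powr (- q / 2))"
    using C(1) by (intro summable_mult) (simp add: summable_real_powr_iff)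
  then have summ: "summable r"
    by (rule summable_comparison_test'[where N = 1]) (use r_le r_nonneg in auto)
  define s where "s = min (1 / 2) (t * h / 8)"
  have s: "0 < s" "s \<le> 1 / 2" "8 * s \<le> t * h"
    using t h by (auto simp: s_def)
  obtain K where K: "\<And>n. K \<le> n \<Longrightarrow> norm (\<Sum>i. r (i + n)) < s"
    using suminf_exist_split[OF s(1) summ] by blast
  have summK: "summable (\<lambda>i. r (i + K))"
    using summ by (simp add: summable_iff_shift)
  have sumK: "(\<Sum>i. r (i + K)) \<le> s"
    using K[of K] by simp
  have r_half: "r (i + K) \<le> 1 / 2" for i
  proof -
    have "r (i + K) \<le> (\<Sum>i. r (i + K))"
      using sum_le_suminf[OF summK, of "{i}"] r_nonneg by simp
    then show ?thesis
      using sumK s by simp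
  qed
  have "\<exists>G\<in>sets M. 1 - h \<le> prob G \<and>
    (\<forall>\<xi>\<in>G. \<forall>\<gamma>\<in>paths_from 0. (\<Sum>i<k. max 0 (\<bar>w (\<gamma> i) \<xi>\<bar> - real K)) \<le> t * real k)" for k
  proof (cases "k = 0")
    case True
    then show ?thesis
      using h by (intro bexI[of _ "UNIV"]) (auto intro: sets.top[of M, simplified])
  next
    case False
    then have k: "0 < real k"
      by simp
    let ?Q = "\<lambda>j Y. Y \<in> borel_measurable M \<and> (\<forall>\<xi>. 0 \<le> Y \<xi>) \<and> integrable M Y \<and>
        expectation Y \<le> 8 * real k * r (j + K) \<and>
        (\<forall>\<xi>. \<forall>\<gamma>\<in>paths_from 0. real (card {i. i < k \<and> real (j + K) < \<bar>w (\<gamma> i) \<xi>\<bar>}) \<le> Y \<xi>)"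
    have ex: "\<exists>Y. ?Q j Y" for j
      by (rule marked_sites_on_paths[of "real (j + K)" "r (j + K)" k])
        (use r_nonneg r_half in \<open>auto simp: r_def\<close>)
    define Y where "Y j = (SOME Y. ?Q j Y)" for j
    have Q: "?Q j (Y j)" for j
      unfolding Y_def by (rule someI_ex[OF ex])
    have Y [measurable]: "Y j \<in> borel_measurable M" and Y_nonneg: "0 \<le> Y j \<xi>"
      and Y_int: "integrable M (Y j)" and Y_exp: "expectation (Y j) \<le> 8 * real k * r (j + K)"
      and Y_card: "\<gamma> \<in> paths_from 0 \<Longrightarrow>
        real (card {i. i < k \<and> real (j + K) < \<bar>w (\<gamma> i) \<xi>\<bar>}) \<le> Y j \<xi>" for j \<xi> \<gamma>
      using Q[of j] by blast+
    define Z where "Z \<xi> = (\<Sum>j. ennreal (Y j \<xi>))" for \<xi>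
    have [measurable]: "Z \<in> borel_measurable M"
      unfolding Z_def by measurable
    have "(\<integral>\<^sup>+\<xi>. Z \<xi> \<partial>M) = (\<Sum>j. \<integral>\<^sup>+\<xi>. Y j \<xi> \<partial>M)"
      unfolding Z_def by (rule nn_integral_suminf) measurable
    also have "\<dots> \<le> (\<Sum>j. ennreal (8 * real k * r (j + K)))"
      using Y_exp Y_nonneg Y_int by (intro suminf_le) (auto simp: nn_integral_eq_integral intro: ennreal_leI)
    also have "\<dots> = ennreal (\<Sum>j. 8 * real k * r (j + K))"
      using r_nonneg by (intro suminf_ennreal2 summable_mult summK) auto
    also have "\<dots> \<le> ennreal (8 * real k * s)"
      unfolding suminf_mult[OF summK] using sumK by (intro ennreal_leI mult_left_mono) auto
    also have "\<dots> \<le> ennreal (t * real k * h)"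
      using mult_left_mono[OF s(3), of "real k"] by (intro ennreal_leI) (simp add: mult_ac)
    finally have Z_int: "(\<integral>\<^sup>+\<xi>. Z \<xi> \<partial>M) \<le> ennreal (t * real k * h)" .
    define G where "G = {\<xi>. Z \<xi> \<le> ennreal (t * real k)}"
    have G [measurable]: "G \<in> sets M"
      unfolding G_def by measurable
    have "emeasure M (UNIV - G) \<le> emeasure M {\<xi>\<in>UNIV. 1 \<le> ennreal (1 / (t * real k)) * Z \<xi>}"
    proof (intro emeasure_mono subsetI CollectI conjI)
      fix \<xi> assume "\<xi> \<in> UNIV - G"
      then have "ennreal (1 / (t * real k)) * ennreal (t * real k) \<le> ennreal (1 / (t * real k)) * Z \<xi>"
        by (intro mult_left_mono) (auto simp: G_def)
      then show "1 \<le> ennreal (1 / (t * real k)) * Z \<xi>"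
        using t k by (simp add: ennreal_mult[symmetric])
    qed auto
    also have "\<dots> \<le> ennreal (1 / (t * real k)) * (\<integral>\<^sup>+\<xi>. Z \<xi> * indicator UNIV \<xi> \<partial>M)"
      by (rule nn_integral_Markov_inequality) (use sets.top[of M] in auto)
    also have "\<dots> \<le> ennreal (1 / (t * real k)) * ennreal (t * real k * h)"
      using Z_int by (intro mult_left_mono) auto
    also have "\<dots> = ennreal h"
      using t k h by (simp add: ennreal_mult[symmetric])
    finally have "prob (UNIV - G) \<le> h"
      using h by (simp add: emeasure_eq_measure)
    then have "1 - h \<le> prob G"
      using prob_compl[OF G] by simp
    moreover have "(\<Sum>i<k. max 0 (\<bar>w (\<gamma> i) \<xi>\<bar> - real K)) \<le> t * real k"
      if "\<xi> \<in> G" and \<gamma>: "\<gamma> \<in> paths_from 0" for \<xi> \<gamma>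
    proof -
      define J where "J = Max ((\<lambda>i. nat \<lceil>\<bar>w (\<gamma> i) \<xi>\<bar>\<rceil>) ` {..<k})"
      have J: "\<bar>w (\<gamma> i) \<xi>\<bar> \<le> real J" if "i < k" for i
      proof -
        have "nat \<lceil>\<bar>w (\<gamma> i) \<xi>\<bar>\<rceil> \<le> J"
          unfolding J_def using that by (intro Max_ge) auto
        then show ?thesis
          by linarith
      qed
      \<comment> \<open>the layer cake formula over integer heights\<close>
      have layer: "max 0 (v - real K) \<le> (\<Sum>j<n. if real (j + K) < v then 1 else 0)"
        if "v \<le> real (n + K)" for v n
        using that
      proof (induction n arbitrary: v)
        case (Suc n)
        show ?case
        proof (cases "v \<le> real (n + K)")
          case True
          with Suc(1)[OF this] show ?thesis
            by simp
        next
          case False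
          then have "(\<Sum>j<Suc n. if real (j + K) < v then 1 else 0) = (\<Sum>j<Suc n. 1 :: real)"
            by (intro sum.cong) auto
          then show ?thesis
            using Suc(2) False by simp
        qed
      qed auto
      have "(\<Sum>i<k. max 0 (\<bar>w (\<gamma> i) \<xi>\<bar> - real K)) \<le>
          (\<Sum>i<k. \<Sum>j<J. if real (j + K) < \<bar>w (\<gamma> i) \<xi>\<bar> then 1 else 0)"
        by (intro sum_mono layer) (use J in fastforce)
      also have "\<dots> = (\<Sum>j<J. \<Sum>i<k. if real (j + K) < \<bar>w (\<gamma> i) \<xi>\<bar> then 1 else 0)"
        by (rule sum.swap)
      also have "\<dots> = (\<Sum>j<J. real (card {i. i < k \<and> real (j + K) < \<bar>w (\<gamma> i) \<xi>\<bar>}))"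
        by (intro sum.cong refl) (simp add: sum.If_cases Int_def)
      also have "\<dots> \<le> (\<Sum>j<J. Y j \<xi>)"
        by (intro sum_mono Y_card \<gamma>)
      finally have "ennreal (\<Sum>i<k. max 0 (\<bar>w (\<gamma> i) \<xi>\<bar> - real K)) \<le> ennreal (\<Sum>j<J. Y j \<xi>)"
        by (rule ennreal_leI)
      also have "\<dots> = (\<Sum>j<J. ennreal (Y j \<xi>))"
        using Y_nonneg by (intro sum_ennreal[symmetric])
      also have "\<dots> \<le> Z \<xi>"
        unfolding Z_def by (intro sum_le_suminf) auto
      also have "\<dots> \<le> ennreal (t * real k)"
        using \<open>\<xi> \<in> G\<close> by (simp add: G_def)
      finally show ?thesis
        using t by (subst (asm) ennreal_le_iff) auto
    qed
    ultimately show ?thesis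
      using G by blast
  qed
  then show ?thesis
    by (rule that)
qed

text \<open>Finite paths from the origin are encoded by the set \<open>S\<close> of times at which they step in
  direction \<open>e1\<close>.\<close>

definition site_of :: "nat set \<Rightarrow> nat \<Rightarrow> site" where
  "site_of S i = (int (card (S \<inter> {..<i})), int i - int (card (S \<inter> {..<i})))"

lemma path_eq_site_of:
  assumes \<gamma>: "\<gamma> \<in> paths_from 0"
  defines "S \<equiv> {i. \<gamma> (Suc i) = \<gamma> i + e1}"
  shows "\<gamma> i = site_of S i"
proof (induction i)
  case (Suc i)
  have "up_right_step (\<gamma> i) (\<gamma> (Suc i))"
    using \<gamma> by (auto simp: paths_from_def)
  moreover have "S \<inter> {..<Suc i} = (if i \<in> S then insert i (S \<inter> {..<i}) else S \<inter> {..<i})"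
    by (auto simp: less_Suc_eq)
  moreover have "i \<in> S \<longleftrightarrow> \<gamma> (Suc i) = \<gamma> i + e1"
    by (simp add: S_def)
  ultimately show ?case
    using Suc by (cases "i \<in> S") (auto simp: site_of_def up_right_step_def e1_def e2_def)
qed (use \<gamma> in \<open>simp add: site_of_def paths_from_def zero_prod_def\<close>)

lemma sum_Pow_card: "finite A \<Longrightarrow> (\<Sum>S\<in>Pow A. x ^ card S) = (1 + x :: real) ^ card A"
proof (induction A rule: finite_induct)
  case (insert a A)
  have inj: "inj_on (insert a) (Pow A)"
    using insert(2) by (auto simp: inj_on_def)
  have "(\<Sum>S\<in>Pow (insert a A). x ^ card S) = (\<Sum>S\<in>Pow A. x ^ card S) + (\<Sum>S\<in>insert a ` Pow A. x ^ card S)"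
    unfolding Pow_insert using insert by (intro sum.union_disjoint) auto
  also have "(\<Sum>S\<in>insert a ` Pow A. x ^ card S) = (\<Sum>S\<in>Pow A. x * x ^ card S)"
    unfolding sum.reindex[OF inj]
  proof (intro sum.cong refl)
    fix S assume "S \<in> Pow A"
    then have "finite S" "a \<notin> S"
      using insert finite_subset by auto
    then show "((\<lambda>S. x ^ card S) \<circ> insert a) S = x * x ^ card S"
      by simp
  qed
  finally show ?case
    using insert by (simp add: sum_distrib_left[symmetric] algebra_simps)
qed simp

text \<open>An exponential moment bound. A path confined to a narrow strip is determined by few steps in
  direction \<open>e1\<close>; weighting each such step by a small factor \<open>x\<close> controls the entropy.\<close>

lemma narrow_paths:
  fixes \<phi> :: "real \<Rightarrow> real" and K e h :: real
  assumes \<phi> [measurable]: "\<phi> \<in> borel_measurable borel" and bd: "\<And>t. \<bar>\<phi> t\<bar> \<le> K"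
    and K: "0 < K" and e: "0 < e" and h: "0 < h"
  defines "\<mu> \<equiv> expectation (\<lambda>\<xi>. \<phi> (w 0 \<xi>))"
  obtains d where "0 < d" "eventually (\<lambda>k. \<exists>G\<in>sets M. 1 - h \<le> prob G \<and>
    (\<forall>\<xi>\<in>G. \<forall>\<gamma>\<in>paths_from 0. real_of_int (fst (\<gamma> k)) \<le> d * real k \<longrightarrow>
      (\<Sum>i<k. \<phi> (w (\<gamma> i) \<xi>)) \<le> (\<mu> + e) * real k)) sequentially"
proof -
  \<comment> \<open>With exponent \<open>l\<close>, Hoeffding's lemma costs \<open>c = l * e / 4\<close> per step, the factor \<open>1 + x\<close> at
    most another \<open>c\<close>, and removing the penalty \<open>x\<close> from at most \<open>d * k\<close> steps a third one; the gain is
    \<open>l * e = 4 * c\<close>.\<close>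
  define l where "l = e / (2 * K\<^sup>2)"
  have l: "0 < l"
    using e K by (simp add: l_def)
  define c where "c = l * e / 4"
  have c: "0 < c"
    using l e by (simp add: c_def)
  define x where "x = min 1 c"
  have x: "0 < x" "x \<le> 1" "x \<le> c"
    using c by (auto simp: x_def)
  define d where "d = c / (1 - ln x)"
  have lnx: "ln x \<le> 0"
    using x by simp
  have d: "0 < d" "- (d * ln x) \<le> c"
  proof -
    show "0 < d"
      using c lnx by (simp add: d_def)
    have "d * (1 - ln x) = c"
      using lnx by (simp add: d_def)
    then show "- (d * ln x) \<le> c"
      using \<open>0 < d\<close> by (simp add: algebra_simps)
  qed
  define \<psi> where "\<psi> t = exp (l * \<phi> t)" for t
  have \<psi> [measurable]: "\<psi> \<in> borel_measurable borel"
    unfolding \<psi>_def[abs_def] by measurable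
  have \<psi>_bd: "\<bar>\<psi> t\<bar> \<le> exp (l * K)" for t
    using bd[of t] l by (auto simp: \<psi>_def)
  have mgf: "expectation (\<lambda>\<xi>. \<psi> (w 0 \<xi>)) \<le> exp (l * \<mu> + c)"
  proof -
    interpret interval_bounded_random_variable M "\<lambda>\<xi>. \<phi> (w 0 \<xi>)" "- K" K
      by unfold_locales (use bd in \<open>auto intro!: AE_I2 simp: abs_le_iff minus_le_iff\<close>)
    have int: "integrable M (\<lambda>\<xi>. exp (l * (\<phi> (w 0 \<xi>) - \<mu>)))"
    proof (rule integrable_const_bound[of _ "exp (l * (K - \<mu>))"])
      show "AE \<xi> in M. norm (exp (l * (\<phi> (w 0 \<xi>) - \<mu>))) \<le> exp (l * (K - \<mu>))"
        using bd l by (intro AE_I2) (simp add: abs_le_iff)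
    qed measurable
    have "(\<integral>\<^sup>+\<xi>. exp (l * (\<phi> (w 0 \<xi>) - \<mu>)) \<partial>M) \<le> ennreal (exp (l\<^sup>2 * (K - - K)\<^sup>2 / 8))"
      using Hoeffdings_lemma_nn_integral[OF l] unfolding \<mu>_def .
    then have "expectation (\<lambda>\<xi>. exp (l * (\<phi> (w 0 \<xi>) - \<mu>))) \<le> exp (l\<^sup>2 * (K - - K)\<^sup>2 / 8)"
      using int by (subst (asm) nn_integral_eq_integral) (auto simp: ennreal_le_iff)
    also have "l\<^sup>2 * (K - - K)\<^sup>2 / 8 = c"
      using K by (simp add: c_def l_def power2_eq_square)
    finally have le: "expectation (\<lambda>\<xi>. exp (l * (\<phi> (w 0 \<xi>) - \<mu>))) \<le> exp c" .
    have "expectation (\<lambda>\<xi>. \<psi> (w 0 \<xi>)) = expectation (\<lambda>\<xi>. exp (l * \<mu>) * exp (l * (\<phi> (w 0 \<xi>) - \<mu>)))"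
      by (intro Bochner_Integration.integral_cong) (simp_all add: \<psi>_def exp_add[symmetric] algebra_simps)
    also have "\<dots> \<le> exp (l * \<mu>) * exp c"
      using le by simp
    finally show ?thesis
      by (simp add: exp_add)
  qed
  define P where "P k S \<xi> = (\<Prod>i<k. \<psi> (w (site_of S i) \<xi>))" for k S \<xi>
  define Z where "Z k \<xi> = (\<Sum>S\<in>Pow {..<k}. x ^ card S * P k S \<xi>)" for k \<xi>
  have P_nonneg: "0 \<le> P k S \<xi>" for k S \<xi>
    by (auto simp: P_def \<psi>_def intro!: prod_nonneg)
  have inj: "inj_on (site_of S) {..<k}" for S k
    by (auto simp: inj_on_def site_of_def)
  have P: "integrable M (P k S)" "expectation (P k S) = expectation (\<lambda>\<xi>. \<psi> (w 0 \<xi>)) ^ k" for k S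
    unfolding P_def using expectation_prod_sites[OF \<psi> \<psi>_bd finite_lessThan inj] by simp_all
  have Z_int: "integrable M (Z k)" for k
    unfolding Z_def by (intro Bochner_Integration.integrable_sum integrable_mult_right P)
  have [measurable]: "Z k \<in> borel_measurable M" for k
    using Z_int by auto
  have Z_nonneg: "0 \<le> Z k \<xi>" for k \<xi>
    unfolding Z_def using x P_nonneg by (intro sum_nonneg mult_nonneg_nonneg) auto
  have Z_exp: "expectation (Z k) \<le> exp (real k * (l * \<mu> + 2 * c))" for k
  proof -
    have nonneg: "0 \<le> expectation (\<lambda>\<xi>. \<psi> (w 0 \<xi>))"
      by (intro Bochner_Integration.integral_nonneg) (simp add: \<psi>_def)
    have "expectation (Z k) = (\<Sum>S\<in>Pow {..<k}. x ^ card S * expectation (\<lambda>\<xi>. \<psi> (w 0 \<xi>)) ^ k)"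
      unfolding Z_def using P by (simp add: Bochner_Integration.integral_sum)
    also have "\<dots> = (1 + x) ^ k * expectation (\<lambda>\<xi>. \<psi> (w 0 \<xi>)) ^ k"
      by (simp add: sum_distrib_right[symmetric] sum_Pow_card)
    also have "\<dots> \<le> exp c ^ k * exp (l * \<mu> + c) ^ k"
    proof (intro mult_mono power_mono)
      show "1 + x \<le> exp c"
        using x exp_ge_add_one_self[of c] by linarith
    qed (use x nonneg mgf in auto)
    also have "\<dots> = exp (real k * (l * \<mu> + 2 * c))"
      by (simp add: exp_of_nat_mult[symmetric] exp_add[symmetric] algebra_simps)
    finally show ?thesis .
  qed
  define b where "b k = exp (real k * (l * (\<mu> + e) + d * ln x))" for k
  have b_pos: "0 < b k" for k
    by (simp add: b_def)
  have bad: "prob {\<xi>. b k \<le> Z k \<xi>} \<le> exp (- c) ^ k" for k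
  proof -
    have "prob {\<xi>\<in>space M. b k \<le> Z k \<xi>} \<le> expectation (Z k) / b k"
      using Z_int Z_nonneg b_pos by (intro integral_Markov_inequality_measure[where A = "{}"]) auto
    also have "\<dots> \<le> exp (real k * (l * \<mu> + 2 * c)) / b k"
      using Z_exp b_pos by (intro divide_right_mono) (auto intro: less_imp_le)
    also have "\<dots> = exp (real k * (l * \<mu> + 2 * c - (l * (\<mu> + e) + d * ln x)))"
      by (simp add: b_def exp_diff[symmetric] algebra_simps)
    also have "\<dots> \<le> exp (real k * (- c))"
      using d(2) by (intro iffD2[OF exp_le_cancel_iff] mult_left_mono) (auto simp: c_def algebra_simps)
    finally show ?thesis
      by (simp only: exp_of_nat_mult space_M UNIV_I simp_thms)
  qed
  have "(\<lambda>k. exp (- c) ^ k) \<longlonglongrightarrow> 0"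
    using c by (intro LIMSEQ_power_zero) simp
  then have "eventually (\<lambda>k. exp (- c) ^ k < h) sequentially"
    using h by (rule order_tendstoD)
  then have "eventually (\<lambda>k. \<exists>G\<in>sets M. 1 - h \<le> prob G \<and>
    (\<forall>\<xi>\<in>G. \<forall>\<gamma>\<in>paths_from 0. real_of_int (fst (\<gamma> k)) \<le> d * real k \<longrightarrow>
      (\<Sum>i<k. \<phi> (w (\<gamma> i) \<xi>)) \<le> (\<mu> + e) * real k)) sequentially"
  proof eventually_elim
    case (elim k)
    define G where "G = {\<xi>. Z k \<xi> < b k}"
    have G [measurable]: "G \<in> sets M"
      unfolding G_def by measurable
    have "UNIV - G = {\<xi>. b k \<le> Z k \<xi>}"
      by (auto simp: G_def)
    then have "1 - h \<le> prob G"
      using prob_compl[OF G] bad[of k] elim by simp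
    moreover have "(\<Sum>i<k. \<phi> (w (\<gamma> i) \<xi>)) \<le> (\<mu> + e) * real k"
      if "\<xi> \<in> G" and \<gamma>: "\<gamma> \<in> paths_from 0" and narrow: "real_of_int (fst (\<gamma> k)) \<le> d * real k" for \<xi> \<gamma>
    proof (rule ccontr)
      assume large: "\<not> ?thesis"
      define S where "S = {i. \<gamma> (Suc i) = \<gamma> i + e1}"
      have site: "\<gamma> i = site_of (S \<inter> {..<k}) i" if "i \<le> k" for i
      proof -
        have "S \<inter> {..<i} = S \<inter> {..<k} \<inter> {..<i}"
          using that by auto
        moreover have "\<gamma> i = site_of S i"
          unfolding S_def by (rule path_eq_site_of[OF \<gamma>])
        ultimately show ?thesis
          by (simp add: site_of_def)
      qed
      have card: "real (card (S \<inter> {..<k})) \<le> d * real k"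
        using narrow site[of k] by (simp add: site_of_def Int_assoc)
      have "b k \<le> x ^ card (S \<inter> {..<k}) * P k (S \<inter> {..<k}) \<xi>"
      proof -
        have "P k (S \<inter> {..<k}) \<xi> = (\<Prod>i<k. exp (l * \<phi> (w (\<gamma> i) \<xi>)))"
          unfolding P_def \<psi>_def by (intro prod.cong) (auto simp: site)
        also have "\<dots> = exp (l * (\<Sum>i<k. \<phi> (w (\<gamma> i) \<xi>)))"
          by (simp add: exp_sum sum_distrib_left)
        finally have P_eq: "P k (S \<inter> {..<k}) \<xi> = exp (l * (\<Sum>i<k. \<phi> (w (\<gamma> i) \<xi>)))" .
        have x_eq: "x ^ card (S \<inter> {..<k}) = exp (real (card (S \<inter> {..<k})) * ln x)"
          using x by (simp add: exp_of_nat_mult)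
        have "d * real k * ln x \<le> real (card (S \<inter> {..<k})) * ln x"
          using card lnx by (intro mult_right_mono_neg)
        moreover have "l * ((\<mu> + e) * real k) \<le> l * (\<Sum>i<k. \<phi> (w (\<gamma> i) \<xi>))"
          using large l by (intro mult_left_mono) auto
        ultimately show ?thesis
          unfolding P_eq x_eq b_def exp_add[symmetric] by (simp add: algebra_simps)
      qed
      also have "\<dots> \<le> Z k \<xi>"
        unfolding Z_def using x P_nonneg by (intro member_le_sum) auto
      finally show False
        using \<open>\<xi> \<in> G\<close> by (simp add: G_def)
    qed
    ultimately show ?case
      using G by blast
  qed
  with d(1) show ?thesis
    by (rule that)
qed

end

section \<open>Stationary cocycles\<close>

lemma paths_from_stepI:
  "\<gamma> 0 = u \<Longrightarrow> (\<And>n. \<gamma> (Suc n) = \<gamma> n + e1 \<or> \<gamma> (Suc n) = \<gamma> n + e2) \<Longrightarrow> \<gamma> \<in> paths_from u"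
  by (auto simp: paths_from_def up_right_step_def)

lemma cocycle_path_in_paths_from: "cocycle_path b u \<in> paths_from u"
  by (rule paths_from_stepI) (auto simp: Let_def)

lemma right_then_up_path:
  "(\<lambda>i. if i \<le> a then (int i, 0) else (int a, int (i - a))) \<in> paths_from 0"
  by (rule paths_from_stepI) (auto simp: e1_def e2_def zero_prod_def)

lemma up_then_right_path:
  "(\<lambda>i. if i \<le> b then (0, int i) else (int (i - b), int b)) \<in> paths_from 0"
  by (rule paths_from_stepI) (auto simp: e1_def e2_def zero_prod_def)

context
  fixes b :: "site \<Rightarrow> site \<Rightarrow> real" and \<omega> :: "site \<Rightarrow> real"
  assumes coc: "cocycle b" and rec: "recovers b \<omega>"
begin

lemma cocycle_add: "b x y + b y z = b x z"
  using coc unfolding cocycle_def by blast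

lemma cocycle_refl: "b x x = 0"
  using cocycle_add[of x x x] by simp

lemma recovers_le: "\<omega> x \<le> b x (x + e1)" "\<omega> x \<le> b x (x + e2)"
  using rec[unfolded recovers_def, rule_format, of x] by auto

lemma cocycle_along_path: "b (\<gamma> 0) (\<gamma> n) = (\<Sum>i<n. b (\<gamma> i) (\<gamma> (Suc i)))"
proof (induction n)
  case (Suc n)
  then show ?case
    using cocycle_add[of "\<gamma> 0" "\<gamma> n" "\<gamma> (Suc n)"] by simp
qed (simp add: cocycle_refl)

lemma cocycle_along_cocycle_path:
  "b u (cocycle_path b u n) = (\<Sum>i<n. \<omega> (cocycle_path b u i))"
proof -
  have "b (cocycle_path b u i) (cocycle_path b u (Suc i)) = \<omega> (cocycle_path b u i)" for i
    using rec[unfolded recovers_def, rule_format, of "cocycle_path b u i"]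
    by (auto simp: Let_def min_def)
  then show ?thesis
    using cocycle_along_path[of "cocycle_path b u" n] by simp
qed

lemma cocycle_row_ge: "(\<Sum>i<n. \<omega> (int i, c)) \<le> b (0, c) (int n, c)"
proof -
  have "(\<Sum>i<n. \<omega> (int i, c)) \<le> (\<Sum>i<n. b (int i, c) (int (Suc i), c))"
    using recovers_le(1)[of "(int i, c)" for i] by (intro sum_mono) (simp add: e1_def add.commute)
  then show ?thesis
    using cocycle_along_path[of "\<lambda>i. (int i, c)" n] by simp
qed

lemma cocycle_column_ge: "(\<Sum>i<n. \<omega> (c, int i)) \<le> b (c, 0) (c, int n)"
proof -
  have "(\<Sum>i<n. \<omega> (c, int i)) \<le> (\<Sum>i<n. b (c, int i) (c, int (Suc i)))"
    using recovers_le(2)[of "(c, int i)" for i] by (intro sum_mono) (simp add: e2_def add.commute)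
  then show ?thesis
    using cocycle_along_path[of "\<lambda>i. (c, int i)" n] by simp
qed

text \<open>Comparing the two ways from the origin to the \<open>k\<close>-th point of the cocycle path bounds the
  cocycle along the axes by passage times.\<close>

lemma cocycle_row_bound:
  assumes c: "\<And>\<gamma>. \<gamma> \<in> paths_from 0 \<Longrightarrow> (\<Sum>i<k. \<bar>\<omega> (\<gamma> i)\<bar>) \<le> c"
  shows "b 0 (fst (cocycle_path b 0 k), 0) \<le> 2 * c"
proof -
  let ?\<gamma> = "cocycle_path b 0"
  note \<gamma> = cocycle_path_in_paths_from[of b 0]
  define n where "n = nat (fst (?\<gamma> k))"
  define m where "m = nat (snd (?\<gamma> k))"
  have nm: "?\<gamma> k = (int n, int m)" "k = n + m"
    using path_from_zero[OF \<gamma>, of k] by (simp_all add: n_def m_def prod_eq_iff)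
  define \<rho> where "\<rho> i = (if i \<le> n then (int i, 0) else (int n, int (i - n)) :: site)" for i
  have "- b (int n, 0) (int n, int m) \<le> - (\<Sum>i<m. \<omega> (int n, int i))"
    using cocycle_column_ge[of "int n" m] by simp
  also have "\<dots> = (\<Sum>i<m. - \<omega> (\<rho> (n + i)))"
    unfolding sum_negf by (auto simp: \<rho>_def intro!: sum.cong)
  also have "\<dots> \<le> (\<Sum>i<m. \<bar>\<omega> (\<rho> (n + i))\<bar>)"
    by (intro sum_mono) auto
  also have "\<dots> = (\<Sum>i\<in>(+) n ` {..<m}. \<bar>\<omega> (\<rho> i)\<bar>)"
    by (subst sum.reindex) auto
  also have "\<dots> \<le> (\<Sum>i<k. \<bar>\<omega> (\<rho> i)\<bar>)"
    by (intro sum_mono2) (auto simp: nm(2))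
  also have "\<dots> \<le> c"
    using right_then_up_path[of n] by (intro c) (simp add: \<rho>_def[abs_def])
  finally have "- b (int n, 0) (int n, int m) \<le> c" .
  moreover have "b 0 (int n, int m) \<le> c"
  proof -
    have "b 0 (?\<gamma> k) \<le> (\<Sum>i<k. \<bar>\<omega> (?\<gamma> i)\<bar>)"
      unfolding cocycle_along_cocycle_path by (intro sum_mono) auto
    with c[OF \<gamma>] show ?thesis
      by (simp add: nm(1))
  qed
  ultimately show ?thesis
    using cocycle_add[of 0 "(int n, 0)" "(int n, int m)"] by (simp add: nm(1))
qed

text \<open>If the path has made few steps in direction \<open>e1\<close>, its weight is estimated by that of the
  truncated weights, and both the tails and the short row that closes the rectangle are small.\<close>

lemma cocycle_column_bound:
  fixes K t s \<delta> :: real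
  assumes tail: "\<And>\<gamma>. \<gamma> \<in> paths_from 0 \<Longrightarrow> (\<Sum>i<k. max 0 (\<bar>\<omega> (\<gamma> i)\<bar> - K)) \<le> t * real k"
    and narrow: "(\<Sum>i<k. max (- K) (min K (\<omega> (cocycle_path b 0 i)))) \<le> s * real k"
    and K: "0 \<le> K" and \<delta>: "real_of_int (fst (cocycle_path b 0 k)) \<le> \<delta> * real k"
  shows "b 0 (0, snd (cocycle_path b 0 k)) \<le> (s + 2 * t + K * \<delta>) * real k"
proof -
  let ?\<gamma> = "cocycle_path b 0"
  note \<gamma> = cocycle_path_in_paths_from[of b 0]
  define n where "n = nat (fst (?\<gamma> k))"
  define m where "m = nat (snd (?\<gamma> k))"
  have nm: "?\<gamma> k = (int n, int m)" "k = m + n"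
    using path_from_zero[OF \<gamma>, of k] by (simp_all add: n_def m_def prod_eq_iff)
  define \<rho> where "\<rho> i = (if i \<le> m then (0, int i) else (int (i - m), int m) :: site)" for i
  have "- b (0, int m) (int n, int m) \<le> - (\<Sum>i<n. \<omega> (int i, int m))"
    using cocycle_row_ge[of "int m" n] by simp
  also have "\<dots> = (\<Sum>i<n. - \<omega> (\<rho> (m + i)))"
    unfolding sum_negf by (auto simp: \<rho>_def intro!: sum.cong)
  also have "\<dots> \<le> (\<Sum>i<n. K + max 0 (\<bar>\<omega> (\<rho> (m + i))\<bar> - K))"
    by (intro sum_mono) auto
  also have "\<dots> = K * real n + (\<Sum>i\<in>(+) m ` {..<n}. max 0 (\<bar>\<omega> (\<rho> i)\<bar> - K))"
    by (subst sum.reindex) (auto simp: sum.distrib)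
  also have "\<dots> \<le> K * real n + (\<Sum>i<k. max 0 (\<bar>\<omega> (\<rho> i)\<bar> - K))"
    by (intro add_left_mono sum_mono2) (auto simp: nm(2))
  also have "\<dots> \<le> K * (\<delta> * real k) + t * real k"
    using up_then_right_path[of m] \<delta> K
    by (intro add_mono mult_left_mono tail) (simp_all add: \<rho>_def[abs_def] nm(1))
  finally have "- b (0, int m) (int n, int m) \<le> K * (\<delta> * real k) + t * real k" .
  moreover have "b 0 (int n, int m) \<le> s * real k + t * real k"
  proof -
    have "b 0 (?\<gamma> k) \<le> (\<Sum>i<k. max (- K) (min K (\<omega> (?\<gamma> i))) + max 0 (\<bar>\<omega> (?\<gamma> i)\<bar> - K))"
      unfolding cocycle_along_cocycle_path by (intro sum_mono) auto
    with narrow tail[OF \<gamma>] show ?thesis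
      by (simp add: nm(1) sum.distrib)
  qed
  ultimately show ?thesis
    using cocycle_add[of 0 "(0, int m)" "(int n, int m)"] by (simp add: nm(1) algebra_simps)
qed

end

lemma (in prob_space) prob_Int_ge:
  assumes A: "A \<in> events" and G: "G \<in> events" "1 - h \<le> prob G"
  shows "prob A - h \<le> prob (A \<inter> G)"
proof -
  have "prob A = prob (A \<inter> G) + prob (A - G)"
    using A G(1) by (simp add: finite_measure_Diff')
  moreover have "prob (A - G) \<le> prob (space M - G)"
    using A G(1) sets.sets_into_space[OF A] by (intro finite_measure_mono) auto
  ultimately show ?thesis
    using prob_compl[OF G(1)] G(2) by linarith
qed

text \<open>A measurable, shift-covariant random cocycle that recovers the weights. Neither integrability
  nor coalescence of its paths is assumed.\<close>

locale stationary_cocycle = extended_space M T w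
  for M :: "'a::polish_space measure" and T w +
  fixes B :: "'a \<Rightarrow> site \<Rightarrow> site \<Rightarrow> real"
  assumes B_measurable [measurable]: "(\<lambda>\<xi>. B \<xi> x y) \<in> borel_measurable M"
    and B_cocycle: "AE \<xi> in M. cocycle (B \<xi>)"
    and B_recovers: "AE \<xi> in M. recovers (B \<xi>) (weights w \<xi>)"
    and B_shift: "AE \<xi> in M. \<forall>x y z. B \<xi> (x + z) (y + z) = B (T z \<xi>) x y"
begin

lemma cocycle_path_measurable [measurable]:
  "(\<lambda>\<xi>. cocycle_path (B \<xi>) u n) \<in> M \<rightarrow>\<^sub>M count_space UNIV"
proof (induction n)
  case (Suc n)
  have "(\<lambda>\<xi>. (\<lambda>x \<xi>. if B \<xi> x (x + e1) \<le> B \<xi> x (x + e2) then x + e1 else x + e2)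
      (cocycle_path (B \<xi>) u n) \<xi>) \<in> M \<rightarrow>\<^sub>M count_space UNIV"
    by (rule measurable_compose_countable[OF _ Suc]) measurable
  then show ?case
    by (simp add: Let_def)
qed simp

lemma B_row:
  "AE \<xi> in M. \<forall>n. B \<xi> 0 (int n, 0) = (\<Sum>i<n. B ((T e1 ^^ i) \<xi>) 0 e1)"
  using B_cocycle B_recovers B_shift
proof eventually_elim
  case (elim \<xi>)
  have "B \<xi> (int i, 0) (int (Suc i), 0) = B (T (int i, 0) \<xi>) 0 e1" for i
    using elim(3)[rule_format, of 0 "(int i, 0)" e1] by (simp add: e1_def zero_prod_def)
  then show ?case
    using cocycle_along_path[OF elim(1,2), of "\<lambda>i. (int i, 0)"]
    by (simp add: T_pow zero_prod_def)
qed

lemma B_column: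
  "AE \<xi> in M. \<forall>n. B \<xi> 0 (0, int n) = (\<Sum>i<n. B ((T e2 ^^ i) \<xi>) 0 e2)"
  using B_cocycle B_recovers B_shift
proof eventually_elim
  case (elim \<xi>)
  have "B \<xi> (0, int i) (0, int (Suc i)) = B (T (0, int i) \<xi>) 0 e2" for i
    using elim(3)[rule_format, of 0 "(0, int i)" e2] by (simp add: e2_def zero_prod_def)
  then show ?case
    using cocycle_along_path[OF elim(1,2), of "\<lambda>i. (0, int i)"]
    by (simp add: T_pow zero_prod_def)
qed

lemma B_ge: "AE \<xi> in M. w 0 \<xi> \<le> B \<xi> 0 e1 \<and> w 0 \<xi> \<le> B \<xi> 0 e2"
  using B_cocycle B_recovers
  by eventually_elim (use recovers_le[where x = 0] in \<open>fastforce simp: weights_def\<close>)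

text \<open>Monotone convergence. The lower bound by the integrable weight at the origin makes the
  truncations integrable.\<close>

lemma integrable_of_truncations:
  fixes f :: "'a \<Rightarrow> real" and c :: real
  assumes f [measurable]: "f \<in> borel_measurable M" and ge: "AE \<xi> in M. w 0 \<xi> \<le> f \<xi>"
    and c: "\<And>n. integrable M (\<lambda>\<xi>. min (f \<xi>) (real n)) \<Longrightarrow> expectation (\<lambda>\<xi>. min (f \<xi>) (real n)) \<le> c"
  shows "integrable M f" "expectation f \<le> c"
proof -
  let ?f = "\<lambda>n \<xi>. min (f \<xi>) (real n)"
  have int: "integrable M (?f n)" for n
  proof (rule Bochner_Integration.integrable_bound[of M "\<lambda>\<xi>. real n + \<bar>w 0 \<xi>\<bar>"])
    show "AE \<xi> in M. norm (?f n \<xi>) \<le> norm (real n + \<bar>w 0 \<xi>\<bar>)"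
      using ge by eventually_elim (auto simp: min_def)
  qed (use w_integrable in auto)
  have mono: "incseq (\<lambda>n. ?f n \<xi>)" for \<xi>
    by (auto simp: incseq_def min_def)
  have lim: "(\<lambda>n. ?f n \<xi>) \<longlonglongrightarrow> f \<xi>" for \<xi>
  proof (rule tendsto_eventually)
    obtain N where N: "f \<xi> \<le> real N"
      using real_arch_simple by blast
    show "eventually (\<lambda>n. ?f n \<xi> = f \<xi>) sequentially"
      using eventually_ge_at_top[of N] by eventually_elim (use N in \<open>auto simp: min_def\<close>)
  qed
  have "incseq (\<lambda>n. expectation (?f n))"
    by (auto simp: incseq_def intro!: integral_mono int)
  then obtain L where L: "(\<lambda>n. expectation (?f n)) \<longlonglongrightarrow> L"
    using incseq_convergent[of "\<lambda>n. expectation (?f n)" c] c[OF int] by blast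
  show "integrable M f"
    by (rule integrable_monotone_convergence[OF int _ _ L]) (use mono lim in auto)
  have "expectation f = L"
    by (rule integral_monotone_convergence[OF int _ _ L]) (use mono lim in auto)
  then show "expectation f \<le> c"
    using L c[OF int] by (auto intro: LIMSEQ_le_const2)
qed

text \<open>If the partial sums of the cocycle in some direction fall below \<open>c\<close> per step, the maximal
  ergodic lemma applied to truncations bounds the mean.\<close>

lemma integrable_of_linear_bound:
  fixes f :: "'a \<Rightarrow> real" and c :: real
  assumes f [measurable]: "f \<in> borel_measurable M" and ge: "AE \<xi> in M. w 0 \<xi> \<le> f \<xi>"
    and lin: "AE \<xi> in M. \<exists>n>0. (\<Sum>i<n. f ((T z ^^ i) \<xi>)) < c * real n"
  shows "integrable M f" "expectation f \<le> c"
proof -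
  have "expectation (\<lambda>\<xi>. min (f \<xi>) (real n)) \<le> c"
    if int: "integrable M (\<lambda>\<xi>. min (f \<xi>) (real n))" for n
  proof -
    have "0 \<le> expectation (\<lambda>\<xi>. c - min (f \<xi>) (real n))"
    proof (rule maximal_ergodic_lemma[OF T_measurable T_invariant])
      show "AE \<xi> in M. \<exists>k. 0 < (\<Sum>i<k. c - min (f ((T z ^^ i) \<xi>)) (real n))"
        using lin
      proof eventually_elim
        case (elim \<xi>)
        then obtain k where k: "(\<Sum>i<k. f ((T z ^^ i) \<xi>)) < c * real k"
          by auto
        moreover have "(\<Sum>i<k. min (f ((T z ^^ i) \<xi>)) (real n)) \<le> (\<Sum>i<k. f ((T z ^^ i) \<xi>))"
          by (intro sum_mono) auto
        ultimately show ?case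
          by (intro exI[of _ k]) (simp add: sum_subtractf mult.commute)
      qed
    qed (use int in auto)
    then show ?thesis
      using int by simp
  qed
  from integrable_of_truncations[OF f ge this]
  show "integrable M f" "expectation f \<le> c"
    by auto
qed

text \<open>The second moments make the squares summable, which gives the sublinearity almost surely.\<close>

lemma weights_sublinear: "AE \<xi> in M. (\<lambda>n. w (int n, 0) \<xi> / real n) \<longlonglongrightarrow> 0"
proof -
  let ?f = "\<lambda>n \<xi>. (w (int n, 0) \<xi> / real n)\<^sup>2"
  define s where "s = expectation (\<lambda>\<xi>. (w 0 \<xi>)\<^sup>2)"
  have "(\<integral>\<^sup>+\<xi>. ennreal (?f n \<xi>) \<partial>M) = ennreal (s * (1 / (real n)\<^sup>2))" for n
    using w_square_integrable[of "(int n, 0)"] w_cong(1)[of "\<lambda>t. t\<^sup>2" "(int n, 0)"]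
    by (subst nn_integral_eq_integral) (auto simp: power_divide s_def)
  then have "(\<integral>\<^sup>+\<xi>. (\<Sum>n. ennreal (?f n \<xi>)) \<partial>M) = (\<Sum>n. ennreal (s * (1 / (real n)\<^sup>2)))"
    by (subst nn_integral_suminf) auto
  also have "\<dots> = ennreal (\<Sum>n. s * (1 / (real n)\<^sup>2))"
    using inverse_power_summable[of 2, where 'a = real]
    by (intro suminf_ennreal2 summable_mult)
      (auto simp: s_def inverse_eq_divide intro!: mult_nonneg_nonneg Bochner_Integration.integral_nonneg)
  finally have "(\<integral>\<^sup>+\<xi>. (\<Sum>n. ennreal (?f n \<xi>)) \<partial>M) \<noteq> \<infinity>"
    by simp
  then have "AE \<xi> in M. (\<Sum>n. ennreal (?f n \<xi>)) \<noteq> \<infinity>"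
    by (intro nn_integral_PInf_AE) auto
  then show ?thesis
  proof eventually_elim
    case (elim \<xi>)
    then have "summable (\<lambda>n. ?f n \<xi>)"
      by (intro summable_suminf_not_top) auto
    then have "(\<lambda>n. ?f n \<xi>) \<longlonglongrightarrow> 0"
      by (rule summable_LIMSEQ_zero)
    then have "(\<lambda>n. sqrt (?f n \<xi>)) \<longlonglongrightarrow> sqrt 0"
      by (rule tendsto_real_sqrt)
    then have "(\<lambda>n. \<bar>w (int n, 0) \<xi> / real n\<bar>) \<longlonglongrightarrow> 0"
      by (simp only: real_sqrt_abs real_sqrt_zero)
    then show ?case
      by (rule tendsto_rabs_zero_cancel)
  qed
qed

text \<open>The event that the lower growth rate of the cocycle along the first axis is at most \<open>c\<close>. It is
  invariant up to null sets.\<close>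

definition slow_growth :: "real \<Rightarrow> 'a set" where
  "slow_growth c = {\<xi>. \<forall>m N. \<exists>n\<ge>N. B \<xi> 0 (int n, 0) \<le> (c + 1 / real (Suc m)) * real n}"

lemma slow_growth_events [measurable]: "slow_growth c \<in> events"
  unfolding slow_growth_def by measurable

lemma slow_growth_zero_one:
  assumes erg: "ergodic M T" and c: "0 \<le> c"
  shows "prob (slow_growth c) \<in> {0, 1}"
proof (rule ergodic_zero_one[OF erg slow_growth_events])
  show "AE \<xi> in M. T e1 \<xi> \<in> slow_growth c \<longrightarrow> \<xi> \<in> slow_growth c"
    using B_cocycle B_recovers B_shift
  proof eventually_elim
    case (elim \<xi>)
    show ?case
    proof
      assume A: "T e1 \<xi> \<in> slow_growth c"
      show "\<xi> \<in> slow_growth c"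
        unfolding slow_growth_def
      proof (intro CollectI allI)
        fix m N
        define u where "u = B \<xi> 0 e1"
        define d where "d = 1 / real (Suc m)"
        have d: "0 < d"
          by (simp add: d_def)
        obtain n where n: "max N (nat \<lceil>u / (d / 2)\<rceil>) \<le> n"
          "B (T e1 \<xi>) 0 (int n, 0) \<le> (c + 1 / real (Suc (2 * m + 1))) * real n"
          using A unfolding slow_growth_def by blast
        have half: "1 / real (Suc (2 * m + 1)) = d / 2"
          by (simp add: d_def field_simps)
        have "u / (d / 2) \<le> real n"
          using n(1) by linarith
        then have u: "u \<le> d / 2 * real n"
          using d by (simp add: field_simps)
        have "B \<xi> 0 (int (Suc n), 0) = u + B (T e1 \<xi>) 0 (int n, 0)"
          using elim(3)[rule_format, of 0 e1 "(int n, 0)"] cocycle_add[OF elim(1,2), of 0 e1 "(int (Suc n), 0)"]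
          by (simp add: u_def e1_def add.commute)
        also have "\<dots> \<le> d / 2 * real n + (c + d / 2) * real n"
          using u n(2) unfolding half by (rule add_mono)
        also have "\<dots> \<le> (c + d) * real (Suc n)"
          using c d by (simp add: algebra_simps)
        finally show "\<exists>n\<ge>N. B \<xi> 0 (int n, 0) \<le> (c + 1 / real (Suc m)) * real n"
          using n(1) by (intro exI[of _ "Suc n"]) (simp add: d_def)
      qed
    qed
  qed
  show "AE \<xi> in M. T e2 \<xi> \<in> slow_growth c \<longrightarrow> \<xi> \<in> slow_growth c"
    using B_cocycle B_recovers B_shift weights_sublinear
  proof eventually_elim
    case (elim \<xi>)
    show ?case
    proof
      assume A: "T e2 \<xi> \<in> slow_growth c"
      show "\<xi> \<in> slow_growth c"
        unfolding slow_growth_def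
      proof (intro CollectI allI)
        fix m N
        define u where "u = B \<xi> 0 e2"
        define d where "d = 1 / real (Suc m)"
        have d: "0 < d"
          by (simp add: d_def)
        have "eventually (\<lambda>n. - (d / 4) < w (int n, 0) \<xi> / real n) sequentially"
          using elim(4) d by (intro order_tendstoD(1)[of _ 0]) auto
        then obtain N' where N': "\<And>n. N' \<le> n \<Longrightarrow> - (d / 4) < w (int n, 0) \<xi> / real n"
          by (auto simp: eventually_sequentially)
        obtain n where n: "max (max N 1) (max N' (nat \<lceil>u / (d / 4)\<rceil>)) \<le> n"
          "B (T e2 \<xi>) 0 (int n, 0) \<le> (c + 1 / real (Suc (2 * m + 1))) * real n"
          using A unfolding slow_growth_def by blast
        have half: "1 / real (Suc (2 * m + 1)) = d / 2"
          by (simp add: d_def field_simps)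
        have "u / (d / 4) \<le> real n"
          using n(1) by linarith
        then have u: "u \<le> d / 4 * real n"
          using d by (simp add: field_simps)
        have "- (d / 4) < w (int n, 0) \<xi> / real n"
          using n(1) by (intro N') simp
        then have wn: "- w (int n, 0) \<xi> \<le> d / 4 * real n"
          using n(1) by (simp add: field_simps)
        have "B (T e2 \<xi>) 0 (int n, 0) = B \<xi> e2 ((int n, 0) + e2)"
          using elim(3)[rule_format, of 0 e2 "(int n, 0)"] by simp
        moreover have "B \<xi> 0 e2 + B \<xi> e2 ((int n, 0) + e2) = B \<xi> 0 ((int n, 0) + e2)"
          "B \<xi> 0 (int n, 0) + B \<xi> (int n, 0) ((int n, 0) + e2) = B \<xi> 0 ((int n, 0) + e2)"
          by (rule cocycle_add[OF elim(1,2)])+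
        moreover have "w (int n, 0) \<xi> \<le> B \<xi> (int n, 0) ((int n, 0) + e2)"
          using recovers_le(2)[OF elim(1,2), of "(int n, 0)"] by (simp add: weights_def)
        ultimately have "B \<xi> 0 (int n, 0) \<le> u + B (T e2 \<xi>) 0 (int n, 0) - w (int n, 0) \<xi>"
          unfolding u_def by linarith
        also have "\<dots> \<le> d / 4 * real n + (c + d / 2) * real n + d / 4 * real n"
          using u wn n(2) unfolding half by linarith
        also have "\<dots> = (c + d) * real n"
          by (simp add: algebra_simps)
        finally show "\<exists>n\<ge>N. B \<xi> 0 (int n, 0) \<le> (c + 1 / real (Suc m)) * real n"
          using n(1) by (intro exI[of _ n]) (simp add: d_def)
      qed
    qed
  qed
qed

text \<open>First case: with probability bounded away from zero the cocycle path keeps a positive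
  proportion of steps in direction \<open>e1\<close>.\<close>

lemma integrable_of_wide_path:
  fixes r h :: real
  assumes erg: "ergodic M T" and r: "0 < r" and h: "0 < h"
    and freq: "frequently (\<lambda>k. 2 * h \<le> prob {\<xi>. r * real k \<le> real_of_int (fst (cocycle_path (B \<xi>) 0 k))})
      sequentially"
  shows "integrable M (\<lambda>\<xi>. B \<xi> 0 e1)"
proof -
  obtain K :: nat where K: "\<And>k. \<exists>G\<in>sets M. 1 - h \<le> prob G \<and>
      (\<forall>\<xi>\<in>G. \<forall>\<gamma>\<in>paths_from 0. (\<Sum>i<k. max 0 (\<bar>w (\<gamma> i) \<xi>\<bar> - real K)) \<le> 1 * real k)"
    by (rule tail_on_paths[of 1 h]) (use h in auto)
  define c where "c = 2 * (real K + 1) / r"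
  have c: "0 \<le> c"
    using r by (simp add: c_def)
  define F where "F N = {\<xi>. \<exists>n\<ge>N. B \<xi> 0 (int n, 0) \<le> c * real n}" for N :: nat
  have F_meas [measurable]: "F N \<in> events" for N
    unfolding F_def by measurable
  have F_ge: "h \<le> prob (F N)" for N
  proof -
    obtain k where k: "nat \<lceil>real N / r\<rceil> \<le> k"
      "2 * h \<le> prob {\<xi>. r * real k \<le> real_of_int (fst (cocycle_path (B \<xi>) 0 k))}"
      using freq unfolding frequently_sequentially by blast
    let ?W = "{\<xi>. r * real k \<le> real_of_int (fst (cocycle_path (B \<xi>) 0 k))}"
    have W [measurable]: "?W \<in> events"
      by measurable
    obtain G where G [measurable]: "G \<in> events" and "1 - h \<le> prob G"
      and tail: "\<And>\<xi> \<gamma>. \<xi> \<in> G \<Longrightarrow> \<gamma> \<in> paths_from 0 \<Longrightarrow>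
        (\<Sum>i<k. max 0 (\<bar>w (\<gamma> i) \<xi>\<bar> - real K)) \<le> real k"
      using K[of k] by auto
    have "h \<le> prob (?W \<inter> G)"
      using prob_Int_ge[OF W G \<open>1 - h \<le> prob G\<close>] k(2) by linarith
    also have "prob (?W \<inter> G) \<le> prob (F N)"
    proof (rule finite_measure_mono_AE)
      show "AE \<xi> in M. \<xi> \<in> ?W \<inter> G \<longrightarrow> \<xi> \<in> F N"
        using B_cocycle B_recovers
      proof eventually_elim
        case (elim \<xi>)
        show ?case
        proof
          assume \<xi>: "\<xi> \<in> ?W \<inter> G"
          let ?\<gamma> = "cocycle_path (B \<xi>) 0"
          define n where "n = nat (fst (?\<gamma> k))"
          have n: "fst (?\<gamma> k) = int n"
            using path_from_zero(1)[OF cocycle_path_in_paths_from] by (simp add: n_def)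
          have "(\<Sum>i<k. \<bar>weights w \<xi> (\<gamma> i)\<bar>) \<le> (real K + 1) * real k" if "\<gamma> \<in> paths_from 0" for \<gamma>
          proof -
            have "(\<Sum>i<k. \<bar>weights w \<xi> (\<gamma> i)\<bar>) \<le> (\<Sum>i<k. real K + max 0 (\<bar>w (\<gamma> i) \<xi>\<bar> - real K))"
              by (intro sum_mono) (auto simp: weights_def)
            also have "\<dots> \<le> real k * real K + real k"
              using tail[of \<xi> \<gamma>] \<xi> that by (simp add: sum.distrib)
            finally show ?thesis
              by (simp add: algebra_simps)
          qed
          from cocycle_row_bound[OF elim this]
          have "B \<xi> 0 (int n, 0) \<le> 2 * ((real K + 1) * real k)"
            by (simp add: n)
          also have "\<dots> = c * (r * real k)"
            using r by (simp add: c_def)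
          also have "\<dots> \<le> c * real n"
            using \<xi> c n by (intro mult_left_mono) auto
          finally have "B \<xi> 0 (int n, 0) \<le> c * real n" .
          moreover have "N \<le> n"
          proof -
            have "real N / r \<le> real k"
              using k(1) by linarith
            then have "real N \<le> r * real k"
              using r by (simp add: field_simps)
            also have "\<dots> \<le> real n"
              using \<xi> n by simp
            finally show ?thesis
              by simp
          qed
          ultimately show "\<xi> \<in> F N"
            by (auto simp: F_def)
        qed
      qed
    qed auto
    finally show ?thesis .
  qed
  have "antimono F"
    by (auto simp: antimono_def F_def intro: order.trans)
  then have "(\<lambda>N. prob (F N)) \<longlonglongrightarrow> prob (\<Inter>N. F N)"
    by (intro finite_Lim_measure_decseq) auto
  then have "h \<le> prob (\<Inter>N. F N)"
    by (rule tendsto_lowerbound) (auto intro!: always_eventually F_ge)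
  also have "\<dots> \<le> prob (slow_growth c)"
  proof (rule finite_measure_mono)
    show "(\<Inter>N. F N) \<subseteq> slow_growth c"
    proof
      fix \<xi> assume \<xi>: "\<xi> \<in> (\<Inter>N. F N)"
      show "\<xi> \<in> slow_growth c"
        unfolding slow_growth_def
      proof (intro CollectI allI)
        fix m N
        obtain n where "n \<ge> N" "B \<xi> 0 (int n, 0) \<le> c * real n"
          using \<xi> by (auto simp: F_def)
        moreover have "c * real n \<le> (c + 1 / real (Suc m)) * real n"
          by (intro mult_right_mono) auto
        ultimately show "\<exists>n\<ge>N. B \<xi> 0 (int n, 0) \<le> (c + 1 / real (Suc m)) * real n"
          by (intro exI[of _ n]) auto
      qed
    qed
  qed auto
  finally have "prob (slow_growth c) = 1"
    using slow_growth_zero_one[OF erg c] h by auto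
  then have "AE \<xi> in M. \<xi> \<in> slow_growth c"
    by (subst (asm) prob_eq_1) auto
  then have "AE \<xi> in M. \<exists>n>0. (\<Sum>i<n. B ((T e1 ^^ i) \<xi>) 0 e1) < (c + 2) * real n"
    using B_row
  proof eventually_elim
    case (elim \<xi>)
    then obtain n where n: "1 \<le> n" "B \<xi> 0 (int n, 0) \<le> (c + 1 / real (Suc 0)) * real n"
      unfolding slow_growth_def by blast
    then have "B \<xi> 0 (int n, 0) < (c + 2) * real n"
      by (simp add: algebra_simps)
    with n elim show ?case
      by (intro exI[of _ n]) auto
  qed
  then show ?thesis
    using B_ge by (intro integrable_of_linear_bound(1)[where c = "c + 2" and z = e1]) auto
qed

end

section \<open>A coboundary cannot be a random walk\<close>

lemma cdf_std_normal_pos: "0 < cdf std_normal_distribution x"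
proof -
  interpret real_distribution std_normal_distribution
    by (rule real_dist_normal_dist)
  have "emeasure std_normal_distribution {..x} \<noteq> 0"
  proof
    assume "emeasure std_normal_distribution {..x} = 0"
    then have "AE y in lborel. ennreal (std_normal_density y) * indicator {..x} y = 0"
      by (subst (asm) emeasure_density) (auto simp: nn_integral_0_iff_AE)
    then have "AE y in lborel. y \<notin> {..x}"
    proof eventually_elim
      case (elim y)
      with normal_density_pos[of 1 0 y] show ?case
        by (auto split: split_indicator_asm)
    qed
    then have "emeasure lborel {..x} = 0"
      by (subst (asm) AE_iff_measurable[OF _ refl]) (auto simp: atMost_def)
    moreover have "emeasure lborel {x - 1..x} \<le> emeasure lborel {..x}"
      by (intro emeasure_mono) auto
    ultimately show False
      by simp
  qed
  then show ?thesis
    by (simp add: cdf_def emeasure_eq_measure zero_less_measure_iff)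
qed

lemma isCont_cdf_std_normal: "isCont (cdf std_normal_distribution) x"
proof -
  interpret real_distribution std_normal_distribution
    by (rule real_dist_normal_dist)
  have "emeasure std_normal_distribution {x} = 0"
    by (subst emeasure_density) (auto simp: nn_integral_0_iff_AE intro!: AE_I[of _ _ "{x}"]
        split: split_indicator)
  then show ?thesis
    unfolding isCont_cdf by (simp add: measure_def)
qed

text \<open>The differences of \<open>f\<close> and its vertical translates are tight, whereas the partial sums of independent centred
  variables of positive variance spread out by the central limit theorem.\<close>

lemma (in extended_space) differences_not_coboundary:
  assumes f [measurable]: "f \<in> borel_measurable M"
    and cob: "\<And>n. AE \<xi> in M. f \<xi> - f (T (0, int n) \<xi>) = (\<Sum>j<n. w (0, int j) \<xi> - w (1, int j) \<xi>)"
  shows False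
proof -
  define X where "X j \<xi> = w (0, int j) \<xi> - w (1, int j) \<xi>" for j \<xi>
  have [measurable]: "X j \<in> borel_measurable M" for j
    by (simp add: X_def[abs_def])
  define K where "K j = {(0, int j), (1, int j) :: site}" for j
  have "indep_vars (\<lambda>j. PiM (K j) (\<lambda>_. borel)) (\<lambda>j \<xi>. restrict (\<lambda>i. w i \<xi>) (K j)) UNIV"
    by (rule indep_vars_restrict[OF w_indep]) (auto simp: disjoint_family_on_def K_def)
  then have "indep_vars (\<lambda>_. borel)
      (\<lambda>j \<xi>. restrict (\<lambda>i. w i \<xi>) (K j) (0, int j) - restrict (\<lambda>i. w i \<xi>) (K j) (1, int j)) UNIV"
    by (rule indep_vars_compose2[where Y = "\<lambda>j p. p (0, int j) - p (1, int j)"])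
      (auto simp: K_def intro!: borel_measurable_diff measurable_component_singleton)
  then have indep: "indep_vars (\<lambda>_. borel) X UNIV"
    by (simp add: K_def X_def[abs_def])
  have w_mean: "expectation (w x) = expectation (w 0)" for x
    using w_cong(1)[of "\<lambda>t. t" x] by simp
  have mean: "expectation (X n) = 0" for n
    using w_mean[of "(0, int n)"] w_mean[of "(1, int n)"]
    by (simp add: X_def[abs_def] w_integrable)
  define v where "v = 2 * (expectation (\<lambda>\<xi>. (w 0 \<xi>)\<^sup>2) - (expectation (w 0))\<^sup>2)"
  have v: "0 < v"
    using w_variance by (simp add: v_def)
  have sq: "integrable M (\<lambda>\<xi>. (X n \<xi>)\<^sup>2)" "expectation (\<lambda>\<xi>. (X n \<xi>)\<^sup>2) = v" for n
  proof -
    let ?a = "(0, int n) :: site" and ?b = "(1, int n) :: site"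
    have ind: "indep_vars (\<lambda>_. borel) w {?a, ?b}"
      by (rule indep_vars_subset[OF w_indep]) (rule subset_UNIV)
    have prod: "(\<Prod>i\<in>{?a, ?b}. g i) = g ?a * g ?b" for g :: "site \<Rightarrow> real"
      by simp
    have fin: "finite {?a, ?b}"
      by simp
    have ab: "integrable M (\<lambda>\<xi>. w ?a \<xi> * w ?b \<xi>)"
      "expectation (\<lambda>\<xi>. w ?a \<xi> * w ?b \<xi>) = (expectation (w 0))\<^sup>2"
      using indep_vars_integrable[OF fin ind w_integrable]
        indep_vars_lebesgue_integral[OF fin ind w_integrable]
      unfolding prod w_mean[of ?a] w_mean[of ?b] by (auto simp: power2_eq_square)
    have X_sq: "(X n \<xi>)\<^sup>2 = (w ?a \<xi>)\<^sup>2 + (w ?b \<xi>)\<^sup>2 - 2 * (w ?a \<xi> * w ?b \<xi>)" for \<xi>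
      by (simp add: X_def power2_eq_square algebra_simps)
    note int = w_square_integrable[of ?a] w_square_integrable[of ?b]
    show "integrable M (\<lambda>\<xi>. (X n \<xi>)\<^sup>2)"
      unfolding X_sq using ab int by auto
    have "expectation (\<lambda>\<xi>. (X n \<xi>)\<^sup>2) = expectation (\<lambda>\<xi>. (w ?a \<xi>)\<^sup>2) +
        expectation (\<lambda>\<xi>. (w ?b \<xi>)\<^sup>2) - 2 * expectation (\<lambda>\<xi>. w ?a \<xi> * w ?b \<xi>)"
      unfolding X_sq using ab(1) int by simp
    also have "\<dots> = v"
      using w_cong(1)[of "\<lambda>t. t\<^sup>2" ?a] w_cong(1)[of "\<lambda>t. t\<^sup>2" ?b] by (simp add: ab(2) v_def)
    finally show "expectation (\<lambda>\<xi>. (X n \<xi>)\<^sup>2) = v" .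
  qed
  have distr: "distr M borel (X n) = distr M borel (X 0)" for n
  proof -
    have "AE \<xi> in M. X n \<xi> = X 0 (T (0, int n) \<xi>)"
      using w_shift[of "(0, 0)" "(0, int n)"] w_shift[of "(1, 0)" "(0, int n)"]
      by eventually_elim (simp add: X_def)
    then have "distr M borel (X n) = distr M borel (\<lambda>\<xi>. X 0 (T (0, int n) \<xi>))"
      by (intro distr_cong_AE) auto
    also have "\<dots> = distr (distr M M (T (0, int n))) borel (X 0)"
      by (subst distr_distr) (auto simp: o_def)
    finally show ?thesis
      by (simp only: T_invariant)
  qed
  let ?Z = "\<lambda>n \<xi>. (\<Sum>i<n. X i \<xi>) / sqrt (real n * (sqrt v)\<^sup>2)"
  have "weak_conv_m (\<lambda>n. distr M borel (?Z n)) std_normal_distribution"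
    by (rule central_limit_theorem_zero_mean[OF indep mean _ sq(1) _ distr])
      (use v sq(2) mean in auto)
  then have lim: "(\<lambda>n. cdf (distr M borel (?Z n)) (- 1)) \<longlonglongrightarrow> cdf std_normal_distribution (- 1)"
    using isCont_cdf_std_normal by (simp add: weak_conv_m_def weak_conv_def)
  \<comment> \<open>The event that the normalised sum is at most \<open>-1\<close> has probability near \<open>4 * h\<close> by the central
    limit theorem, but at most \<open>2 * h\<close> by tightness.\<close>
  define h where "h = cdf std_normal_distribution (- 1) / 4"
  have h: "0 < h"
    using cdf_std_normal_pos by (simp add: h_def)
  have "(\<lambda>N. prob {\<xi>. real N \<le> \<bar>f \<xi>\<bar>}) \<longlonglongrightarrow> prob (\<Inter>N. {\<xi>. real N \<le> \<bar>f \<xi>\<bar>})"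
    by (intro finite_Lim_measure_decseq) (auto simp: antimono_def)
  also have "(\<Inter>N. {\<xi>. real N \<le> \<bar>f \<xi>\<bar>}) = {}"
  proof (intro equals0I)
    fix \<xi> assume \<xi>: "\<xi> \<in> (\<Inter>N. {\<xi>. real N \<le> \<bar>f \<xi>\<bar>})"
    obtain N where "\<bar>f \<xi>\<bar> < real N"
      using reals_Archimedean2 by blast
    moreover have "real N \<le> \<bar>f \<xi>\<bar>"
      using \<xi> by simp
    ultimately show False
      by simp
  qed
  finally have "eventually (\<lambda>N. prob {\<xi>. real N \<le> \<bar>f \<xi>\<bar>} < h) sequentially"
    using h by (intro order_tendstoD(2)) auto
  then obtain N where N: "prob {\<xi>. real N \<le> \<bar>f \<xi>\<bar>} < h"
    by (auto simp: eventually_sequentially)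
  have "eventually (\<lambda>n. 2 * real N < sqrt (real n * v)) sequentially"
  proof -
    have "filterlim (\<lambda>n. sqrt (real n * v)) at_top sequentially"
      using v by (intro filterlim_compose[OF sqrt_at_top]
          filterlim_at_top_mult_tendsto_pos[OF tendsto_const _ filterlim_real_sequentially]) auto
    then show ?thesis
      by (simp add: filterlim_at_top_dense)
  qed
  moreover have "eventually (\<lambda>n. 2 * h < cdf (distr M borel (?Z n)) (- 1)) sequentially"
    using lim h by (intro order_tendstoD(1)) (auto simp: h_def)
  ultimately have "eventually (\<lambda>n. 2 * real N < sqrt (real n * v) \<and>
      2 * h < cdf (distr M borel (?Z n)) (- 1)) sequentially"
    by (rule eventually_conj)
  then obtain n where n: "2 * real N < sqrt (real n * v)" "2 * h < cdf (distr M borel (?Z n)) (- 1)"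
    by (auto simp: eventually_sequentially)
  have f_T [measurable]: "(\<lambda>\<xi>. f (T (0, int n) \<xi>)) \<in> borel_measurable M"
    by measurable
  have "cdf (distr M borel (?Z n)) (- 1) = prob {\<xi>. ?Z n \<xi> \<le> - 1}"
    by (auto simp: cdf_def measure_distr intro!: arg_cong[where f = prob])
  also have "\<dots> \<le> prob ({\<xi>. real N \<le> \<bar>f \<xi>\<bar>} \<union> {\<xi>. real N \<le> \<bar>f (T (0, int n) \<xi>)\<bar>})"
  proof (rule finite_measure_mono_AE)
    show "AE \<xi> in M. \<xi> \<in> {\<xi>. ?Z n \<xi> \<le> - 1} \<longrightarrow>
        \<xi> \<in> {\<xi>. real N \<le> \<bar>f \<xi>\<bar>} \<union> {\<xi>. real N \<le> \<bar>f (T (0, int n) \<xi>)\<bar>}"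
      using cob[of n]
    proof eventually_elim
      case (elim \<xi>)
      have "f \<xi> - f (T (0, int n) \<xi>) \<le> - sqrt (real n * v)" if "?Z n \<xi> \<le> - 1"
      proof -
        have pos: "0 < sqrt (real n * v)"
          using n(1) by linarith
        have "(f \<xi> - f (T (0, int n) \<xi>)) / sqrt (real n * v) \<le> - 1"
          using that v elim by (simp add: X_def)
        then show ?thesis
          using pos by (simp add: field_simps)
      qed
      then show ?case
        using n(1) by (auto simp: not_le abs_if split: if_splits)
    qed
  qed auto
  also have "\<dots> \<le> prob {\<xi>. real N \<le> \<bar>f \<xi>\<bar>} + prob {\<xi>. real N \<le> \<bar>f (T (0, int n) \<xi>)\<bar>}"
    by (rule measure_Un_le) auto
  also have "prob {\<xi>. real N \<le> \<bar>f (T (0, int n) \<xi>)\<bar>} = prob {\<xi>. real N \<le> \<bar>f \<xi>\<bar>}"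
    using prob_T[of "{\<xi>. real N \<le> \<bar>f \<xi>\<bar>}" "(0, int n)"] by (simp add: vimage_def)
  finally show False
    using N n(2) by simp
qed

section \<open>Integrability of stationary cocycles\<close>

context stationary_cocycle
begin

text \<open>Second case: the proportion of steps in direction \<open>e1\<close> vanishes in probability. Then the
  cocycle along the second axis grows no faster than the mean weight, so that it equals the weight
  at every site, and its increments across a column form a coboundary that is a random walk.\<close>

lemma column_slow_growth:
  fixes t :: real
  assumes narrow: "\<And>r. 0 < r \<Longrightarrow>
      (\<lambda>k. prob {\<xi>. r * real k \<le> real_of_int (fst (cocycle_path (B \<xi>) 0 k))}) \<longlonglongrightarrow> 0"
    and t: "0 < t"
  shows "AE \<xi> in M. \<exists>n>0. B \<xi> 0 (0, int n) \<le> (expectation (w 0) + 6 * t) * real n"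
proof -
  define m where "m = expectation (w 0)"
  define D where "D = {\<xi>. \<exists>n>0. B \<xi> 0 (0, int n) \<le> (m + 6 * t) * real n}"
  have D [measurable]: "D \<in> events"
    unfolding D_def by measurable
  have "1 - 3 * h \<le> prob D" if h: "0 < h" for h
  proof -
    obtain K0 :: nat where K0: "\<And>k. \<exists>G\<in>sets M. 1 - h \<le> prob G \<and>
        (\<forall>\<xi>\<in>G. \<forall>\<gamma>\<in>paths_from 0. (\<Sum>i<k. max 0 (\<bar>w (\<gamma> i) \<xi>\<bar> - real K0)) \<le> t * real k)"
      by (rule tail_on_paths[OF t h]) blast
    let ?\<phi> = "\<lambda>(K::nat) v. max (- real K) (min (real K) v)"
    have "(\<lambda>K. expectation (\<lambda>\<xi>. ?\<phi> K (w 0 \<xi>))) \<longlonglongrightarrow> m"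
      unfolding m_def
    proof (rule integral_dominated_convergence[where w = "\<lambda>\<xi>. \<bar>w 0 \<xi>\<bar>"])
      show "AE \<xi> in M. (\<lambda>K. ?\<phi> K (w 0 \<xi>)) \<longlonglongrightarrow> w 0 \<xi>"
      proof (intro AE_I2 tendsto_eventually)
        fix \<xi>
        obtain N where N: "\<bar>w 0 \<xi>\<bar> \<le> real N"
          using real_arch_simple by blast
        show "eventually (\<lambda>K. ?\<phi> K (w 0 \<xi>) = w 0 \<xi>) sequentially"
          using eventually_ge_at_top[of N] by eventually_elim (use N in auto)
      qed
    qed (auto simp: w_integrable)
    then have "eventually (\<lambda>K. expectation (\<lambda>\<xi>. ?\<phi> K (w 0 \<xi>)) < m + t) sequentially"
      using t by (intro order_tendstoD(2)) auto
    then have "eventually (\<lambda>K. expectation (\<lambda>\<xi>. ?\<phi> K (w 0 \<xi>)) < m + t \<and> K0 \<le> K \<and> 0 < K) sequentially"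
      by (intro eventually_conj eventually_ge_at_top eventually_gt_at_top)
    then obtain K :: nat where K: "expectation (\<lambda>\<xi>. ?\<phi> K (w 0 \<xi>)) < m + t" "K0 \<le> K" "0 < K"
      by (auto simp: eventually_sequentially)
    define \<mu> where "\<mu> = expectation (\<lambda>\<xi>. ?\<phi> K (w 0 \<xi>))"
    have K_pos: "0 < real K"
      using K by simp
    have \<phi>_meas: "?\<phi> K \<in> borel_measurable borel"
      by measurable
    have \<phi>_bd: "\<bar>?\<phi> K v\<bar> \<le> real K" for v
      by auto
    obtain d where d: "0 < d" "eventually (\<lambda>k. \<exists>G\<in>sets M. 1 - h \<le> prob G \<and>
        (\<forall>\<xi>\<in>G. \<forall>\<gamma>\<in>paths_from 0. real_of_int (fst (\<gamma> k)) \<le> d * real k \<longrightarrow>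
          (\<Sum>i<k. ?\<phi> K (w (\<gamma> i) \<xi>)) \<le> (\<mu> + t) * real k)) sequentially"
      unfolding \<mu>_def by (rule narrow_paths[OF \<phi>_meas \<phi>_bd K_pos t h])
    define a where "a = 2 * (\<bar>m + 5 * t\<bar> + 1)"
    have a: "0 < a"
    proof -
      have "0 < 2 * (u + 1)" if "0 \<le> u" for u :: real
        using that by simp
      from this[OF abs_ge_zero] show ?thesis
        unfolding a_def .
    qed
    define r where "r = min (min d (1 / 2)) (min (t / real K) (t / a))"
    have "r \<le> min (min d (1 / 2)) (min (t / real K) (t / a))"
      by (simp only: r_def)
    then have r_le: "r \<le> d" "r \<le> 1 / 2" "r \<le> t / real K" "r \<le> t / a"
      unfolding min.bounded_iff by blast+
    have "0 < r"
      unfolding r_def using d(1) t K_pos a by simp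
    note r = this r_le
    have rK: "real K * r \<le> t"
      using r(4) K_pos by (simp add: field_simps)
    have rm: "2 * (\<bar>m + 5 * t\<bar> * r) \<le> t"
    proof -
      have "r * a \<le> t"
        using r(5) a by (simp add: pos_le_divide_eq)
      moreover have "0 \<le> r"
        using r(1) by simp
      ultimately show ?thesis
        by (simp add: a_def algebra_simps)
    qed
    have "eventually (\<lambda>k. prob {\<xi>. r * real k \<le> real_of_int (fst (cocycle_path (B \<xi>) 0 k))} < h) sequentially"
      using narrow[OF r(1)] h by (rule order_tendstoD(2))
    then have "eventually (\<lambda>k. 1 - 3 * h \<le> prob D) sequentially"
      using d(2) eventually_gt_at_top[of 0]
    proof eventually_elim
      case (elim k)
      let ?N = "{\<xi>. real_of_int (fst (cocycle_path (B \<xi>) 0 k)) < r * real k}"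
      have N [measurable]: "?N \<in> events"
        by measurable
      have "UNIV - ?N = {\<xi>. r * real k \<le> real_of_int (fst (cocycle_path (B \<xi>) 0 k))}"
        by auto
      then have N_prob: "1 - h \<le> prob ?N"
        using prob_compl[OF N] elim(1) by simp
      obtain G1 where G1 [measurable]: "G1 \<in> events" and G1_prob: "1 - h \<le> prob G1"
        and tail: "\<And>\<xi> \<gamma>. \<xi> \<in> G1 \<Longrightarrow> \<gamma> \<in> paths_from 0 \<Longrightarrow>
          (\<Sum>i<k. max 0 (\<bar>w (\<gamma> i) \<xi>\<bar> - real K0)) \<le> t * real k"
        using K0[of k] by blast
      obtain G2 where G2 [measurable]: "G2 \<in> events" and G2_prob: "1 - h \<le> prob G2"
        and bulk: "\<And>\<xi> \<gamma>. \<xi> \<in> G2 \<Longrightarrow> \<gamma> \<in> paths_from 0 \<Longrightarrow> real_of_int (fst (\<gamma> k)) \<le> d * real k \<Longrightarrow>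
          (\<Sum>i<k. ?\<phi> K (w (\<gamma> i) \<xi>)) \<le> (\<mu> + t) * real k"
        using elim(2) by blast
      have "1 - 3 * h \<le> prob (?N \<inter> G1 \<inter> G2)"
        using prob_Int_ge[OF N G1 G1_prob] prob_Int_ge[OF sets.Int[OF N G1] G2 G2_prob] N_prob
        by linarith
      also have "\<dots> \<le> prob D"
      proof (rule finite_measure_mono_AE)
        show "AE \<xi> in M. \<xi> \<in> ?N \<inter> G1 \<inter> G2 \<longrightarrow> \<xi> \<in> D"
          using B_cocycle B_recovers
        proof eventually_elim
          case (elim \<xi>)
          note coc = elim
          show ?case
          proof
            assume \<xi>: "\<xi> \<in> ?N \<inter> G1 \<inter> G2"
            let ?\<gamma> = "cocycle_path (B \<xi>) 0"
            note \<gamma> = cocycle_path_in_paths_from[of "B \<xi>" 0]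
            have x: "real_of_int (fst (?\<gamma> k)) \<le> r * real k"
              using \<xi> by simp
            also have "\<dots> \<le> d * real k"
              using r by (intro mult_right_mono) auto
            finally have xd: "real_of_int (fst (?\<gamma> k)) \<le> d * real k" .
            define n where "n = nat (snd (?\<gamma> k))"
            have n: "snd (?\<gamma> k) = int n"
              using path_from_zero(2)[OF \<gamma>] by (simp add: n_def)
            have n_eq: "real n = real k - real_of_int (fst (?\<gamma> k))"
            proof -
              have "real_of_int (fst (?\<gamma> k) + int n) = real_of_int (int k)"
                using path_from_zero(3)[OF \<gamma>, of k] n by simp
              then show ?thesis
                by simp
            qed
            have n_half: "real k \<le> 2 * real n"
            proof -
              have "r * real k \<le> 1 / 2 * real k"
                using r by (intro mult_right_mono) auto
              with x n_eq show ?thesis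
                by simp
            qed
            have "B \<xi> 0 (0, int n) \<le> ((\<mu> + t) + 2 * t + real K * r) * real k"
              unfolding n[symmetric]
            proof (rule cocycle_column_bound[OF coc])
              fix \<gamma> :: "nat \<Rightarrow> site" assume "\<gamma> \<in> paths_from 0"
              then have "(\<Sum>i<k. max 0 (\<bar>w (\<gamma> i) \<xi>\<bar> - real K0)) \<le> t * real k"
                using tail \<xi> by blast
              moreover have "(\<Sum>i<k. max 0 (\<bar>w (\<gamma> i) \<xi>\<bar> - real K)) \<le>
                  (\<Sum>i<k. max 0 (\<bar>w (\<gamma> i) \<xi>\<bar> - real K0))"
                using K(2) by (intro sum_mono) auto
              ultimately show "(\<Sum>i<k. max 0 (\<bar>weights w \<xi> (\<gamma> i)\<bar> - real K)) \<le> t * real k"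
                by (simp add: weights_def)
            next
              show "(\<Sum>i<k. max (- real K) (min (real K) (weights w \<xi> (?\<gamma> i)))) \<le> (\<mu> + t) * real k"
                using bulk[OF _ \<gamma> xd] \<xi> by (simp add: weights_def)
            qed (use x in auto)
            also have "\<dots> \<le> (m + 5 * t) * real k"
              using K(1) rK by (intro mult_right_mono) (auto simp: \<mu>_def)
            also have "\<dots> = (m + 5 * t) * real n + (m + 5 * t) * real_of_int (fst (?\<gamma> k))"
              by (simp add: n_eq algebra_simps)
            also have "(m + 5 * t) * real_of_int (fst (?\<gamma> k)) \<le> \<bar>m + 5 * t\<bar> * (r * (2 * real n))"
            proof -
              have "r * real k \<le> r * (2 * real n)"
                using n_half r(1) by (intro mult_left_mono) auto
              then have "\<bar>m + 5 * t\<bar> * real_of_int (fst (?\<gamma> k)) \<le> \<bar>m + 5 * t\<bar> * (r * (2 * real n))"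
                using x by (intro mult_left_mono) auto
              moreover have "(m + 5 * t) * real_of_int (fst (?\<gamma> k)) \<le>
                  \<bar>m + 5 * t\<bar> * real_of_int (fst (?\<gamma> k))"
                using path_from_zero(1)[OF \<gamma>, of k] by (intro mult_right_mono) auto
              ultimately show ?thesis
                by linarith
            qed
            also have "\<bar>m + 5 * t\<bar> * (r * (2 * real n)) = 2 * (\<bar>m + 5 * t\<bar> * r) * real n"
              by simp
            also have "\<dots> \<le> t * real n"
              using rm by (intro mult_right_mono) auto
            finally have "B \<xi> 0 (0, int n) \<le> (m + 6 * t) * real n"
              by (simp add: algebra_simps)
            moreover have "0 < n"
              using n_half \<open>0 < k\<close> by linarith
            ultimately show "\<xi> \<in> D"
              by (auto simp: D_def)
          qed
        qed
      qed auto
      finally show ?case .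
    qed
    then show ?thesis
      by simp
  qed
  note D_prob = this
  have "1 \<le> prob D"
  proof (rule field_le_epsilon)
    fix e :: real assume "0 < e"
    then show "1 \<le> prob D + e"
      using D_prob[of "e / 3"] by simp
  qed
  then have "prob D = 1"
    using prob_le_1[of D] by linarith
  then have "AE \<xi> in M. \<xi> \<in> D"
    by (subst (asm) prob_eq_1) auto
  then show ?thesis
    by eventually_elim (auto simp: D_def m_def)
qed

lemma path_not_narrow:
  assumes narrow: "\<And>r. 0 < r \<Longrightarrow>
      (\<lambda>k. prob {\<xi>. r * real k \<le> real_of_int (fst (cocycle_path (B \<xi>) 0 k))}) \<longlonglongrightarrow> 0"
  shows False
proof -
  let ?g = "\<lambda>\<xi>. B \<xi> 0 e2"
  define m where "m = expectation (w 0)"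
  have ge: "AE \<xi> in M. w 0 \<xi> \<le> ?g \<xi>"
    using B_ge by eventually_elim simp
  have slow: "AE \<xi> in M. \<exists>n>0. B \<xi> 0 (0, int n) \<le> (m + 6 * t) * real n" if "0 < t" for t
    unfolding m_def by (rule column_slow_growth[OF _ that]) (rule narrow)
  have lin: "AE \<xi> in M. \<exists>n>0. (\<Sum>i<n. ?g ((T e2 ^^ i) \<xi>)) < (m + 7 * t) * real n" if t: "0 < t" for t
    using slow[OF t] B_column
  proof eventually_elim
    case (elim \<xi>)
    then obtain n where n: "0 < n" "B \<xi> 0 (0, int n) \<le> (m + 6 * t) * real n"
      by blast
    have "(m + 6 * t) * real n < (m + 7 * t) * real n"
      using n t by (intro mult_strict_right_mono) auto
    moreover have "(\<Sum>i<n. ?g ((T e2 ^^ i) \<xi>)) = B \<xi> 0 (0, int n)"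
      using elim(2) by simp
    ultimately show ?case
      using n by (intro exI[of _ n] conjI) linarith+
  qed
  have g: "integrable M ?g" "\<And>t. 0 < t \<Longrightarrow> expectation ?g \<le> m + 7 * t"
    using integrable_of_linear_bound[OF B_measurable ge lin] zero_less_one by blast+
  have "expectation ?g \<le> m"
  proof (rule field_le_epsilon)
    fix e :: real assume "0 < e"
    then show "expectation ?g \<le> m + e"
      using g(2)[of "e / 7"] by simp
  qed
  then have "expectation (\<lambda>\<xi>. ?g \<xi> - w 0 \<xi>) \<le> 0"
    using g(1) w_integrable by (simp add: m_def)
  moreover have "0 \<le> expectation (\<lambda>\<xi>. ?g \<xi> - w 0 \<xi>)"
    using ge by (intro integral_nonneg_AE) auto
  ultimately have "expectation (\<lambda>\<xi>. ?g \<xi> - w 0 \<xi>) = 0"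
    by simp
  then have "AE \<xi> in M. ?g \<xi> - w 0 \<xi> = 0"
    using ge g(1) w_integrable by (subst (asm) integral_nonneg_eq_0_iff_AE) auto
  then have eq0: "AE \<xi> in M. ?g \<xi> = w 0 \<xi>"
    by eventually_elim simp
  have "AE \<xi> in M. ?g (T x \<xi>) = w x \<xi>" for x
    using AE_T[OF eq0, of x] w_shift[of 0 x] by eventually_elim simp
  then have "AE \<xi> in M. \<forall>x. ?g (T x \<xi>) = w x \<xi>"
    by (subst AE_all_countable) auto
  then have col: "AE \<xi> in M. \<forall>x. B \<xi> x (x + e2) = w x \<xi>"
    using B_shift
  proof eventually_elim
    case (elim \<xi>)
    show ?case
    proof
      fix x
      show "B \<xi> x (x + e2) = w x \<xi>"
        using elim(1)[rule_format, of x] elim(2)[rule_format, of 0 x e2] by (simp add: add.commute)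
    qed
  qed
  let ?f = "\<lambda>\<xi>. B \<xi> 0 e1"
  have cob: "AE \<xi> in M. ?f \<xi> - ?f (T (0, int n) \<xi>) = (\<Sum>j<n. w (0, int j) \<xi> - w (1, int j) \<xi>)" for n
    using col B_cocycle B_recovers B_shift
  proof eventually_elim
    case (elim \<xi>)
    have sum: "B \<xi> (c, 0) (c, int n) = (\<Sum>j<n. w (c, int j) \<xi>)" for c
    proof -
      have "B \<xi> (c, int j) (c, int (Suc j)) = w (c, int j) \<xi>" for j
        using elim(1)[rule_format, of "(c, int j)"] by (simp add: e2_def add.commute)
      then show ?thesis
        using cocycle_along_path[OF elim(2,3), of "\<lambda>j. (c, int j)" n] by simp
    qed
    have "?f (T (0, int n) \<xi>) = B \<xi> (0, int n) (1, int n)"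
      using elim(4)[rule_format, of 0 "(0, int n)" e1] by (simp add: e1_def)
    moreover have "B \<xi> 0 e1 + B \<xi> (1, 0) (1, int n) = B \<xi> 0 (0, int n) + B \<xi> (0, int n) (1, int n)"
      using cocycle_add[OF elim(2,3), of 0 e1 "(1, int n)"]
        cocycle_add[OF elim(2,3), of 0 "(0, int n)" "(1, int n)"] by (simp add: e1_def)
    ultimately show ?case
      using sum[of 0] sum[of 1] by (simp add: sum_subtractf zero_prod_def)
  qed
  show False
    by (rule differences_not_coboundary[OF B_measurable cob])
qed

lemma integrable_e1:
  assumes erg: "ergodic M T"
  shows "integrable M (\<lambda>\<xi>. B \<xi> 0 e1)"
proof (rule ccontr)
  let ?p = "\<lambda>r k. prob {\<xi>. r * real k \<le> real_of_int (fst (cocycle_path (B \<xi>) 0 k))}"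
  assume not_int: "\<not> ?thesis"
  have "?p r \<longlonglongrightarrow> 0" if r: "0 < r" for r
  proof (rule tendstoI)
    fix e :: real assume e: "0 < e"
    have "\<not> frequently (\<lambda>k. 2 * (e / 2) \<le> ?p r k) sequentially"
      using integrable_of_wide_path[OF erg r, of "e / 2"] e not_int by auto
    then show "eventually (\<lambda>k. dist (?p r k) 0 < e) sequentially"
      by (simp add: not_frequently not_le)
  qed
  then show False
    by (rule path_not_narrow)
qed

lemma stationary_cocycle_swap:
  "stationary_cocycle M (\<lambda>z. T (prod.swap z)) (\<lambda>x. w (prod.swap x))
    (\<lambda>\<xi> x y. B \<xi> (prod.swap x) (prod.swap y))"
proof (intro stationary_cocycle.intro extended_space_swap stationary_cocycle_axioms.intro)
  show "AE \<xi> in M. cocycle (\<lambda>x y. B \<xi> (prod.swap x) (prod.swap y))"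
    using B_cocycle by eventually_elim (unfold cocycle_def, blast)
  show "AE \<xi> in M. recovers (\<lambda>x y. B \<xi> (prod.swap x) (prod.swap y)) (weights (\<lambda>x. w (prod.swap x)) \<xi>)"
    using B_recovers
  proof eventually_elim
    case (elim \<xi>)
    show ?case
      unfolding recovers_def
    proof
      fix x :: site
      show "min (B \<xi> (prod.swap x) (prod.swap (x + e1))) (B \<xi> (prod.swap x) (prod.swap (x + e2))) =
          weights (\<lambda>x. w (prod.swap x)) \<xi> x"
        using elim[unfolded recovers_def, rule_format, of "prod.swap x"]
        by (simp add: swap_add weights_def min.commute)
    qed
  qed
  show "AE \<xi> in M. \<forall>x y z. B \<xi> (prod.swap (x + z)) (prod.swap (y + z)) =
      B (T (prod.swap z) \<xi>) (prod.swap x) (prod.swap y)"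
    using B_shift
  proof eventually_elim
    case (elim \<xi>)
    show ?case
      unfolding swap_add using elim by blast
  qed
qed measurable

theorem cocycle_integrable:
  assumes erg: "ergodic M T"
  shows "integrable M (\<lambda>\<xi>. B \<xi> x y)"
proof -
  interpret swapped: stationary_cocycle M "\<lambda>z. T (prod.swap z)" "\<lambda>x. w (prod.swap x)"
    "\<lambda>\<xi> x y. B \<xi> (prod.swap x) (prod.swap y)"
    by (rule stationary_cocycle_swap)
  have e1: "integrable M (\<lambda>\<xi>. B \<xi> 0 e1)"
    by (rule integrable_e1[OF erg])
  have e2: "integrable M (\<lambda>\<xi>. B \<xi> 0 e2)"
    using swapped.integrable_e1[OF ergodic_swap[OF erg]] by simp
  have shift: "integrable M (\<lambda>\<xi>. B \<xi> z (x + z)) \<longleftrightarrow> integrable M (\<lambda>\<xi>. B \<xi> 0 x)" for x z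
  proof -
    have "AE \<xi> in M. B \<xi> z (x + z) = B (T z \<xi>) 0 x"
      using B_shift by eventually_elim (metis add_0)
    then have "integrable M (\<lambda>\<xi>. B \<xi> z (x + z)) \<longleftrightarrow> integrable M (\<lambda>\<xi>. B (T z \<xi>) 0 x)"
      by (intro integrable_cong_AE) auto
    also have "\<dots> \<longleftrightarrow> integrable M (\<lambda>\<xi>. B \<xi> 0 x)"
      by (rule integral_T(1)[OF B_measurable])
    finally show ?thesis .
  qed
  have "integrable M (\<lambda>\<xi>. B \<xi> 0 x)" for x
  proof (induction x rule: site_induct)
    case zero
    have "AE \<xi> in M. B \<xi> 0 0 = 0"
      using B_cocycle B_recovers by eventually_elim (rule cocycle_refl)
    then show ?case
      by (subst integrable_cong_AE[where g = "\<lambda>_. 0"]) auto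
  next
    case (add x y)
    have "AE \<xi> in M. B \<xi> 0 (x + y) = B \<xi> 0 y + B \<xi> y (x + y)"
      using B_cocycle B_recovers by eventually_elim (rule cocycle_add[symmetric])
    then have "integrable M (\<lambda>\<xi>. B \<xi> 0 (x + y)) \<longleftrightarrow> integrable M (\<lambda>\<xi>. B \<xi> 0 y + B \<xi> y (x + y))"
      by (intro integrable_cong_AE) auto
    then show ?case
      using add shift[of y x] by simp
  next
    case (minus x)
    have "AE \<xi> in M. B \<xi> 0 (- x) = - B \<xi> (- x) (x + - x)"
      using B_cocycle B_recovers
    proof eventually_elim
      case (elim \<xi>)
      show ?case
        using cocycle_add[OF elim, of 0 "- x" 0] cocycle_refl[OF elim, of 0] by simp
    qed
    then have "integrable M (\<lambda>\<xi>. B \<xi> 0 (- x)) \<longleftrightarrow> integrable M (\<lambda>\<xi>. - B \<xi> (- x) (x + - x))"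
      by (intro integrable_cong_AE) auto
    then show ?case
      using minus shift[of "- x" x] by simp
  qed (use e1 e2 in auto)
  then show ?thesis
    using shift[of x "y - x"] by simp
qed

end

section \<open>Busemann functions of coalescing systems\<close>

lemma passage_time_measurable:
  assumes [measurable]: "\<And>x. w x \<in> borel_measurable M"
  shows "(\<lambda>\<xi>. passage_time (weights w \<xi>) p) \<in> borel_measurable M"
proof -
  have "(\<lambda>\<xi>. \<Sum>x\<leftarrow>q. weights w \<xi> x) \<in> borel_measurable M" for q
    by (induction q) (simp_all add: weights_def)
  then show ?thesis
    by (simp add: passage_time_def)
qed

lemma last_passage_measurable:
  assumes "\<And>x. w x \<in> borel_measurable M"
  shows "(\<lambda>\<xi>. last_passage (weights w \<xi>) u v) \<in> borel_measurable M"
  unfolding last_passage_def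
  by (intro borel_measurable_Max passage_time_measurable assms finite_finite_paths)

lemma random_geodesic_measurable:
  assumes "random_geodesic M w u \<gamma>"
  shows "(\<lambda>\<xi>. \<gamma> \<xi> n) \<in> M \<rightarrow>\<^sub>M count_space UNIV"
proof -
  have "\<gamma> \<in> M \<rightarrow>\<^sub>M borel"
    using assms by (auto simp: random_geodesic_def measurable_restrict_space2_iff)
  then have "(\<lambda>\<xi>. \<gamma> \<xi> n) \<in> borel_measurable M"
    by (rule measurable_compose[OF _ measurable_product_coordinates])
  then show ?thesis
    by (simp add: measurable_cong_sets[OF refl sets_borel_eq_count_space])
qed

text \<open>Covariance of the Busemann function combines covariance of the geodesics, which turns the
  geodesic from \<open>0\<close> at the shifted point into the one from \<open>z\<close>, with the fact that all geodesics
  of the system generate the same Busemann function.\<close>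

lemma (in extended_space) G_hat_stationary_cocycle:
  assumes \<pi>: "\<pi> \<in> G_hat M T w"
  shows "stationary_cocycle M T w (geodesic_busemann w (\<pi> 0))"
    and "AE \<xi> in M. \<forall>u. cocycle_path (geodesic_busemann w (\<pi> 0) \<xi>) u = \<pi> u \<xi>"
proof -
  let ?B = "geodesic_busemann w (\<pi> 0)"
  have rand: "random_geodesic M w u (\<pi> u)" for u
    using \<pi> unfolding G_hat_def geodesic_system_def by blast
  have "AE \<xi> in M. \<forall>u. \<pi> u \<xi> \<in> Geo (weights w \<xi>) u"
    by (subst AE_all_countable) (use rand in \<open>auto simp: random_geodesic_def\<close>)
  moreover have "AE \<xi> in M. \<forall>u v. coalesce (\<pi> u \<xi>) (\<pi> v \<xi>)"
    using \<pi> by (auto simp: G_hat_def coalescing_system_def)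
  ultimately have coal: "AE \<xi> in M. coalescing_geodesics (weights w \<xi>) (\<lambda>u. \<pi> u \<xi>)"
    by eventually_elim (rule coalescing_geodesics.intro, auto)
  show "AE \<xi> in M. \<forall>u. cocycle_path (?B \<xi>) u = \<pi> u \<xi>"
    using coal
  proof eventually_elim
    case (elim \<xi>)
    from coalescing_geodesics.cocycle_path_busemann[OF this] show ?case
      unfolding geodesic_busemann_def by blast
  qed
  have shift_w: "AE \<xi> in M. \<forall>x z. w x (T z \<xi>) = w (x + z) \<xi>"
    unfolding AE_all_countable using w_shift by blast
  have shift_\<pi>: "AE \<xi> in M. \<forall>u. \<pi> u \<xi> = (\<lambda>n. u + \<pi> 0 (T u \<xi>) n)"
    using \<pi> by (auto simp: G_hat_def shift_covariant_def)
  show "stationary_cocycle M T w ?B"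
  proof (intro stationary_cocycle.intro stationary_cocycle_axioms.intro)
    show "extended_space M T w"
      by (rule extended_space_axioms)
    have "(\<lambda>\<xi>. last_passage (weights w \<xi>) x (\<pi> 0 \<xi> n)) \<in> borel_measurable M" for x n
      by (rule measurable_compose_countable[OF _ random_geodesic_measurable[OF rand]])
        (rule last_passage_measurable, rule w_measurable)
    then show "(\<lambda>\<xi>. ?B \<xi> x y) \<in> borel_measurable M" for x y
      unfolding geodesic_busemann_def busemann_def
      by (intro borel_measurable_lim_metric borel_measurable_diff)
    show "AE \<xi> in M. cocycle (?B \<xi>)"
      using coal unfolding geodesic_busemann_def
      by eventually_elim (rule coalescing_geodesics.busemann_cocycle)
    show "AE \<xi> in M. recovers (?B \<xi>) (weights w \<xi>)"
      using coal unfolding geodesic_busemann_def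
      by eventually_elim (rule coalescing_geodesics.busemann_recovers)
    show "AE \<xi> in M. \<forall>x y z. ?B \<xi> (x + z) (y + z) = ?B (T z \<xi>) x y"
      using coal shift_w shift_\<pi>
    proof eventually_elim
      case (elim \<xi>)
      show ?case
      proof (intro allI)
        fix x y z
        have weights: "weights w (T z \<xi>) = (\<lambda>x. weights w \<xi> (x + z))"
          using elim(2) unfolding weights_def by blast
        have path: "\<pi> z \<xi> n = \<pi> 0 (T z \<xi>) n + z" for n
          using elim(3)[rule_format, of z] by (simp add: add.commute)
        have "?B (T z \<xi>) x y = busemann (weights w \<xi>) (\<pi> z \<xi>) (x + z) (y + z)"
          unfolding geodesic_busemann_def busemann_def weights last_passage_shift path ..
        also have "\<dots> = ?B \<xi> (x + z) (y + z)"
          unfolding geodesic_busemann_def by (rule coalescing_geodesics.busemann_unique[OF elim(1)])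
        finally show "?B \<xi> (x + z) (y + z) = ?B (T z \<xi>) x y" ..
      qed
    qed
  qed
qed

lemma (in stationary_cocycle) in_K_hat:
  assumes int: "\<And>x y. integrable M (\<lambda>\<xi>. B \<xi> x y)"
  shows "B \<in> K_hat M T w"
proof -
  let ?N = "M \<Otimes>\<^sub>M (count_space UNIV :: site measure) \<Otimes>\<^sub>M (count_space UNIV :: site measure)"
  have "(\<lambda>p. B (fst p) x (snd (snd p))) \<in> borel_measurable ?N" for x
    by (rule measurable_compose_countable[where f = "\<lambda>y p. B (fst p) x y"]) measurable
  then have "(\<lambda>p. B (fst p) (fst (snd p)) (snd (snd p))) \<in> borel_measurable ?N"
    by (rule measurable_compose_countable[where f = "\<lambda>x p. B (fst p) x (snd (snd p))"]) measurable
  then have "(\<lambda>(\<xi>, x, y). B \<xi> x y)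
      \<in> borel_measurable (M \<Otimes>\<^sub>M count_space UNIV \<Otimes>\<^sub>M count_space UNIV)"
    by (simp add: case_prod_beta)
  moreover have "AE \<xi> in M. cocycle (B \<xi>) \<and> recovers (B \<xi>) (weights w \<xi>)"
    using B_cocycle B_recovers by eventually_elim simp
  ultimately show ?thesis
    using B_shift int by (simp add: K_hat_def)
qed

theorem theorem3p17:
  fixes M :: "'a::polish_space measure"
    and T :: "site \<Rightarrow> 'a \<Rightarrow> 'a"
    and w :: "site \<Rightarrow> 'a \<Rightarrow> real"
    and \<pi> :: "site \<Rightarrow> 'a \<Rightarrow> nat \<Rightarrow> site"
  assumes "extended_space M T w"
    and "\<pi> \<in> G_hat M T w"
  shows "measure M {\<xi> \<in> space M. \<forall>u. cocycle_path (geodesic_busemann w (\<pi> 0) \<xi>) u = \<pi> u \<xi>} = 1 \<and>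
         (ergodic M T \<longrightarrow> geodesic_busemann w (\<pi> 0) \<in> K_hat_c M T w)"
proof -
  interpret extended_space M T w
    by (rule assms(1))
  let ?B = "geodesic_busemann w (\<pi> 0)"
  interpret stationary_cocycle M T w ?B
    by (rule G_hat_stationary_cocycle(1)[OF assms(2)])
  have eq: "AE \<xi> in M. \<forall>u. cocycle_path (?B \<xi>) u = \<pi> u \<xi>"
    by (rule G_hat_stationary_cocycle(2)[OF assms(2)])
  have "random_geodesic M w u (\<pi> u)" for u
    using assms(2) unfolding G_hat_def geodesic_system_def by blast
  then have [measurable]: "(\<lambda>\<xi>. \<pi> u \<xi> n) \<in> M \<rightarrow>\<^sub>M count_space UNIV" for u n
    by (rule random_geodesic_measurable)
  have "{\<xi> \<in> space M. \<forall>u. cocycle_path (?B \<xi>) u = \<pi> u \<xi>} =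
      {\<xi> \<in> space M. \<forall>u n x. cocycle_path (?B \<xi>) u n = x \<longleftrightarrow> \<pi> u \<xi> n = x}"
    by (auto simp only: fun_eq_iff)
  also have "\<dots> \<in> events"
    by measurable
  finally have "prob {\<xi> \<in> space M. \<forall>u. cocycle_path (?B \<xi>) u = \<pi> u \<xi>} = 1"
    using eq by (subst prob_Collect_eq_1) auto
  moreover have "?B \<in> K_hat_c M T w" if "ergodic M T"
  proof -
    have "AE \<xi> in M. \<forall>u v. coalesce (\<pi> u \<xi>) (\<pi> v \<xi>)"
      using assms(2) by (auto simp: G_hat_def coalescing_system_def)
    then have "AE \<xi> in M. \<forall>u v. coalesce (cocycle_path (?B \<xi>) u) (cocycle_path (?B \<xi>) v)"
      using eq by eventually_elim simp
    then show ?thesis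
      using in_K_hat[OF cocycle_integrable[OF that]] by (simp add: K_hat_c_def)
  qed
  ultimately show ?thesis
    by blast
qed

end
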